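(* Let $n\ge 1$, $s\in(0,\frac12)$, let $\Omega\subset\mathbb{R}^n$ be a bounded Lipschitz domain, $W$ a double-well potential with minima at $\pm1$, and $g:\mathbb{R}^n\to[-1,1]$ continuous. Let $\mathcal{F}^{(k)}$, $m_k$, $\mathcal{U}_k$ be the $\Gamma$-asymptotic development of $\mathcal{F}_\varepsilon$ defined in the context. If $m_1=0$, then, for all integers $k\ge2$, $$\mathcal{F}^{(k)}(u)=\begin{cases}0&\text{if }u\in\mathcal{U}_1,\\+\infty&\text{otherwise,}\end{cases}$$ and, consequently, $m_k=0$ and $\mathcal{U}_k=\mathcal{U}_1$.
   Context: Notation: $A^c=\mathbb{R}^n\setminus A$; $\chi_A$ is the indicator function of $A$. $\Omega$ is open and not necessarily connected. $W$ is continuous on $[-1,1]$, with $W(\pm1)=0$ and $W>0$ in $(-1,1)$. $X_g$ is the set of measurable functions $u:\mathbb{R}^n\to[-1,1]$ with $u=g$ in $\mathbb{R}^n\setminus\Omega$. Convergence in $X_g$ is with respect to the metric of $L^1(\Omega)$. Let $Q_\Omega:=(\mathbb{R}^n\times\mathbb{R}^n)\setminus(\Omega^c\times\Omega^c)$ and $u(Q_\Omega):=\iint_{Q_\Omega}\frac{|u(x)-u(y)|^2}{|x-y|^{n+2s}}\,dx\,dy$. For $\varepsilon>0$ and $u\in X_g$, $$\mathcal{F}_\varepsilon(u):=\varepsilon\,u(Q_\Omega)+\varepsilon^{1-2s}\int_\Omega W(u(x))\,dx.$$ $\Gamma$-limit: $\mathcal{G}$ is the $\Gamma$-limit of $\mathcal{G}_\varepsilon$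 (on $X_g$, with respect to $L^1(\Omega)$ convergence) if for every $u\in X_g$ and every $\varepsilon_j\searrow0$: $\liminf_j\mathcal{G}_{\varepsilon_j}(u_j)\ge\mathcal{G}(u)$ for every sequence $u_j\in X_g$ with $u_j\to u$, and there is a sequence $u_j\in X_g$ with $u_j\to u$ and $\limsup_j\mathcal{G}_{\varepsilon_j}(u_j)\le\mathcal{G}(u)$. Asymptotic development: $\mathcal{U}_{-1}:=X_g$, $\mathcal{F}^{(0)}_\varepsilon:=\mathcal{F}_\varepsilon$, and $\mathcal{F}^{(0)}$ is the $\Gamma$-limit of $\mathcal{F}^{(0)}_\varepsilon$. Inductively, for $j\ge0$, $$m_j:=\inf_{\mathcal{U}_{j-1}}\mathcal{F}^{(j)},\qquad \mathcal{U}_j:=\{u\in\mathcal{U}_{j-1}:\mathcal{F}^{(j)}(u)=m_j\},\qquad \mathcal{F}^{(j+1)}_\varepsilon:=\frac{\mathcal{F}^{(j)}_\varepsilon-m_j}{\varepsilon},$$ and $\mathcal{F}^{(j+1)}$ is the $\Gamma$-limit of $\mathcal{F}^{(j+1)}_\varepsilon$ as $\varepsilon\searrow0$. It is known that $\mathcal{F}^{(0)}\equiv0$ on $X_g$ (so $m_0=0$, $\mathcal{U}_0=X_g$, and $\mathcal{F}^{(1)}_\varepsilon(u)=u(Q_\Omega)+\varepsilon^{-2s}\int_\Omega W(u)\,dx$) and that $$\mathcal{F}^{(1)}(u)=\iint_{\Omega\times\Omega}\frac{|u(x)-u(y)|^2}{|x-y|^{n+2s}}\,dx\,dy+2\iint_{\Omega\times\Omega^c}\frac{|u(x)-g(y)|^2}{|x-y|^{n+2s}}\,dx\,dy$$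 if $u\in X_g$ and $u|_\Omega=\chi_E-\chi_{E^c}$ for some measurable $E\subset\mathbb{R}^n$, and $\mathcal{F}^{(1)}(u)=+\infty$ otherwise. Thus $m_1=\inf_{X_g}\mathcal{F}^{(1)}$ and $\mathcal{U}_1$ is the set of minimizers of $\mathcal{F}^{(1)}$ in $X_g$. *)

theory Defs
  imports "HOL-Analysis.Analysis"
begin

text \<open>
  Gamma-limits of families indexed by a real parameter tending to zero from above.  The distance
  \<open>d\<close> only has to be a pseudometric: for the \<open>L\<^sup>1(\<Omega>)\<close> distance, functions are not
  identified when they agree almost everywhere.
\<close>

definition gamma_limit_at ::
  "'u set \<Rightarrow> ('u \<Rightarrow> 'u \<Rightarrow> ennreal) \<Rightarrow> (real \<Rightarrow> 'u \<Rightarrow> ereal) \<Rightarrow> 'u \<Rightarrow> ereal \<Rightarrow> bool"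
  where "gamma_limit_at X d G u l \<longleftrightarrow>
    (\<forall>e :: nat \<Rightarrow> real. (\<forall>j. 0 < e j) \<and> decseq e \<and> e \<longlonglongrightarrow> 0 \<longrightarrow>
      (\<forall>v :: nat \<Rightarrow> 'u. (\<forall>j. v j \<in> X) \<and> (\<lambda>j. d (v j) u) \<longlonglongrightarrow> 0 \<longrightarrow>
         l \<le> liminf (\<lambda>j. G (e j) (v j))) \<and>
      (\<exists>v :: nat \<Rightarrow> 'u. (\<forall>j. v j \<in> X) \<and> (\<lambda>j. d (v j) u) \<longlonglongrightarrow> 0 \<and>
         limsup (\<lambda>j. G (e j) (v j)) \<le> l))"

definition is_gamma_limit ::
  "'u set \<Rightarrow> ('u \<Rightarrow> 'u \<Rightarrow> ennreal) \<Rightarrow> (real \<Rightarrow> 'u \<Rightarrow> ereal) \<Rightarrow> ('u \<Rightarrow> ereal) \<Rightarrow> bool"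
  where "is_gamma_limit X d G L \<longleftrightarrow> (\<forall>u\<in>X. gamma_limit_at X d G u (L u))"

definition gamma_lim ::
  "'u set \<Rightarrow> ('u \<Rightarrow> 'u \<Rightarrow> ennreal) \<Rightarrow> (real \<Rightarrow> 'u \<Rightarrow> ereal) \<Rightarrow> 'u \<Rightarrow> ereal"
  where "gamma_lim X d G u = (THE l. gamma_limit_at X d G u l)"

lemma gamma_limit_at_unique:
  assumes "gamma_limit_at X d G u l" "gamma_limit_at X d G u l'"
  shows "l = l'"
proof -
  have le: "a \<le> b" if a: "gamma_limit_at X d G u a" and b: "gamma_limit_at X d G u b" for a b
  proof -
    define e :: "nat \<Rightarrow> real" where "e = (\<lambda>j. inverse (real (Suc j)))"
    have e: "(\<forall>j. 0 < e j) \<and> decseq e \<and> e \<longlonglongrightarrow> 0"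
      unfolding e_def using LIMSEQ_inverse_real_of_nat by (auto simp: decseq_def field_simps)
    obtain v where v: "\<forall>j. v j \<in> X" "(\<lambda>j. d (v j) u) \<longlonglongrightarrow> 0"
      "limsup (\<lambda>j. G (e j) (v j)) \<le> b"
      using b e unfolding gamma_limit_at_def by blast
    have "a \<le> liminf (\<lambda>j. G (e j) (v j))"
      using a e v unfolding gamma_limit_at_def by blast
    also have "\<dots> \<le> limsup (\<lambda>j. G (e j) (v j))"
      by (rule Liminf_le_Limsup) simp
    finally show ?thesis using v(3) by simp
  qed
  show ?thesis using le assms by (meson order_antisym)
qed

lemma gamma_lim_eq:
  assumes "is_gamma_limit X d G L" "u \<in> X"
  shows "gamma_lim X d G u = L u"
  using assms unfolding is_gamma_limit_def gamma_lim_def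
  by (blast intro: the_equality gamma_limit_at_unique)

text \<open>
  The asymptotic development of a family \<open>F\<close>.  The set \<open>dev_dom X d F j\<close> is
  \<open>\<U>\<^bsub>j-1\<^esub>\<close>, so that the convention \<open>\<U>\<^bsub>-1\<^esub> = X\<close> becomes \<open>dev_dom X d F 0 = X\<close>.
  Gamma-limits are always taken on the whole of \<open>X\<close>, while \<open>m\<^sub>j\<close> is the infimum over
  \<open>\<U>\<^bsub>j-1\<^esub>\<close> only.
\<close>

fun dev_eps ::
    "'u set \<Rightarrow> ('u \<Rightarrow> 'u \<Rightarrow> ennreal) \<Rightarrow> (real \<Rightarrow> 'u \<Rightarrow> ereal) \<Rightarrow> nat \<Rightarrow> real \<Rightarrow> 'u \<Rightarrow> ereal"
  and dev_dom ::
    "'u set \<Rightarrow> ('u \<Rightarrow> 'u \<Rightarrow> ennreal) \<Rightarrow> (real \<Rightarrow> 'u \<Rightarrow> ereal) \<Rightarrow> nat \<Rightarrow> 'u set"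
  where
    "dev_eps X d F 0 = F"
  | "dev_eps X d F (Suc j) =
       (\<lambda>e u. (dev_eps X d F j e u
               - (INF v\<in>dev_dom X d F j. gamma_lim X d (dev_eps X d F j) v)) / ereal e)"
  | "dev_dom X d F 0 = X"
  | "dev_dom X d F (Suc j) =
       {u \<in> dev_dom X d F j. gamma_lim X d (dev_eps X d F j) u
               = (INF v\<in>dev_dom X d F j. gamma_lim X d (dev_eps X d F j) v)}"

text \<open>\<open>dev_lim\<close>, \<open>dev_min\<close>, \<open>dev_set\<close> are \<open>\<F>\<^bsup>(j)\<^esup>\<close>, \<open>m\<^sub>j\<close>, \<open>\<U>\<^sub>j\<close>.\<close>

definition dev_lim ::
  "'u set \<Rightarrow> ('u \<Rightarrow> 'u \<Rightarrow> ennreal) \<Rightarrow> (real \<Rightarrow> 'u \<Rightarrow> ereal) \<Rightarrow> nat \<Rightarrow> 'u \<Rightarrow> ereal"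
  where "dev_lim X d F j = gamma_lim X d (dev_eps X d F j)"

definition dev_min ::
  "'u set \<Rightarrow> ('u \<Rightarrow> 'u \<Rightarrow> ennreal) \<Rightarrow> (real \<Rightarrow> 'u \<Rightarrow> ereal) \<Rightarrow> nat \<Rightarrow> ereal"
  where "dev_min X d F j = (INF u\<in>dev_dom X d F j. dev_lim X d F j u)"

definition dev_set ::
  "'u set \<Rightarrow> ('u \<Rightarrow> 'u \<Rightarrow> ennreal) \<Rightarrow> (real \<Rightarrow> 'u \<Rightarrow> ereal) \<Rightarrow> nat \<Rightarrow> 'u set"
  where "dev_set X d F j = dev_dom X d F (Suc j)"

text \<open>
  Near each boundary point, after a rotation taking \<open>\<nu>\<close> to the last coordinate direction, the set
  is the strict epigraph of a Lipschitz function \<open>\<psi>\<close> on the hyperplane orthogonal to \<open>\<nu>\<close>; the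
  vector \<open>x - (x \<bullet> \<nu>) *\<^sub>R \<nu>\<close> is the projection of \<open>x\<close> to that hyperplane.  Connectedness
  is not required.
\<close>

definition bounded_lipschitz_domain :: "(real ^ 'n) set \<Rightarrow> bool"
  where "bounded_lipschitz_domain \<Omega> \<longleftrightarrow> open \<Omega> \<and> bounded \<Omega> \<and>
    (\<forall>p\<in>frontier \<Omega>. \<exists>\<nu> r L \<psi>. norm \<nu> = 1 \<and> 0 < r \<and>
       L-lipschitz_on {z :: real ^ 'n. z \<bullet> \<nu> = 0} (\<psi> :: real ^ 'n \<Rightarrow> real) \<and>
       \<Omega> \<inter> ball p r = {x \<in> ball p r. \<psi> (x - (x \<bullet> \<nu>) *\<^sub>R \<nu>) < x \<bullet> \<nu>})"

definition double_well :: "(real \<Rightarrow> real) \<Rightarrow> bool"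
  where "double_well W \<longleftrightarrow> continuous_on {-1..1} W \<and> W (-1) = 0 \<and> W 1 = 0 \<and>
    (\<forall>t\<in>{-1<..<1}. 0 < W t)"

definition Xg :: "(real ^ 'n) set \<Rightarrow> (real ^ 'n \<Rightarrow> real) \<Rightarrow> (real ^ 'n \<Rightarrow> real) set"
  where "Xg \<Omega> g = {u \<in> borel_measurable lebesgue.
    (\<forall>x. u x \<in> {-1..1}) \<and> (\<forall>x. x \<notin> \<Omega> \<longrightarrow> u x = g x)}"

definition L1_dist ::
  "(real ^ 'n) set \<Rightarrow> (real ^ 'n \<Rightarrow> real) \<Rightarrow> (real ^ 'n \<Rightarrow> real) \<Rightarrow> ennreal"
  where "L1_dist \<Omega> u v = (\<integral>\<^sup>+x\<in>\<Omega>. ennreal \<bar>u x - v x\<bar> \<partial>lebesgue)"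

definition Q_set :: "(real ^ 'n) set \<Rightarrow> ((real ^ 'n) \<times> (real ^ 'n)) set"
  where "Q_set \<Omega> = UNIV \<times> UNIV - (- \<Omega>) \<times> (- \<Omega>)"

text \<open>On the diagonal, a null set, the quotient below is \<open>0 / 0 = 0\<close>.\<close>

definition Q_energy :: "(real ^ 'n) set \<Rightarrow> real \<Rightarrow> (real ^ 'n \<Rightarrow> real) \<Rightarrow> ennreal"
  where "Q_energy \<Omega> s u =
    (\<integral>\<^sup>+p\<in>Q_set \<Omega>. ennreal (\<bar>u (fst p) - u (snd p)\<bar>\<^sup>2
        / norm (fst p - snd p) powr (real CARD('n) + 2 * s)) \<partial>lebesgue)"

definition F_eps ::
  "(real ^ 'n) set \<Rightarrow> real \<Rightarrow> (real \<Rightarrow> real) \<Rightarrow> real \<Rightarrow> (real ^ 'n \<Rightarrow> real) \<Rightarrow> ereal"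
  where "F_eps \<Omega> s W e u = enn2ereal (ennreal e * Q_energy \<Omega> s u
    + ennreal (e powr (1 - 2 * s)) * (\<integral>\<^sup>+x\<in>\<Omega>. ennreal (W (u x)) \<partial>lebesgue))"

end

theory Submission
  imports Defs
begin

text \<open>
  Write \<open>Q\<close> for the nonlocal energy and \<open>D\<close> for the set of \<open>u \<in> X\<close> with \<open>Q u < \<infinity>\<close>.  The
  limit \<open>\<F>\<^bsup>(0)\<^esup>\<close> is \<open>0\<close> on the \<open>L\<^sup>1\<close>-closure of \<open>D\<close> and \<open>\<infinity>\<close> elsewhere; the set \<open>D\<close> is
  nonempty since otherwise \<open>m\<^sub>1 = \<infinity>\<close>.  This suffices for \<open>m\<^sub>0 = 0\<close>, and the exact
  domain of the later steps is irrelevant because every zero of \<open>\<F>\<^bsup>(1)\<^esup>\<close> lies in \<open>D\<close>.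

  By Fatou's lemma \<open>\<F>\<^bsup>(1)\<^esup>\<close> is \<open>Q\<close> on phase indicators and \<open>\<infinity>\<close> elsewhere.  If \<open>m\<^sub>1 = 0\<close>, a
  minimizing sequence has vanishing interaction between its two phases, so it approaches a pure
  phase, which is a zero of \<open>\<F>\<^bsup>(1)\<^esup>\<close> by lower semicontinuity.  The approximating functionals also
  vanish at the zeros of \<open>\<F>\<^bsup>(1)\<^esup>\<close>, while elsewhere their positive liminf is sent to infinity by each
  further division by \<open>\<epsilon>\<close>.
\<close>

section \<open>Asymptotic developments of nonnegative functionals\<close>

text \<open>The limit only sees whether \<open>D\<close> comes arbitrarily close to
  \<open>u\<close>. If it does, points of \<open>D\<close> chosen closer and closer, but slowly
  enough for their energies to vanish, form a recovery sequence. If it does not, every competitor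
  near \<open>u\<close> has infinite energy. Closeness is expressed through \<open>d v u\<close>
  because only \<open>d u u = 0\<close> is known about \<open>d\<close>.\<close>

lemma gamma_limit_at_finiteness_domain:
  fixes F :: "real \<Rightarrow> 'u \<Rightarrow> ereal"
  assumes "D \<subseteq> X" and nonneg: "\<And>e v. 0 < e \<Longrightarrow> v \<in> X \<Longrightarrow> 0 \<le> F e v"
    and vanish: "\<And>v. v \<in> D \<Longrightarrow> ((\<lambda>e. F e v) \<longlongrightarrow> 0) (at_right 0)"
    and infinite: "\<And>e v. 0 < e \<Longrightarrow> v \<in> X - D \<Longrightarrow> F e v = \<infinity>"
    and refl: "d u u = 0" and "u \<in> X"
  shows "gamma_limit_at X d F u (if \<forall>\<delta>>0. \<exists>v\<in>D. d v u < \<delta> then 0 else \<infinity>)"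
  unfolding gamma_limit_at_def
proof (intro allI impI conjI)
  fix e :: "nat \<Rightarrow> real" assume e: "(\<forall>j. 0 < e j) \<and> decseq e \<and> e \<longlonglongrightarrow> 0"
  show "\<exists>v. (\<forall>j. v j \<in> X) \<and> (\<lambda>j. d (v j) u) \<longlonglongrightarrow> 0 \<and>
    limsup (\<lambda>j. F (e j) (v j)) \<le> (if \<forall>\<delta>>0. \<exists>v\<in>D. d v u < \<delta> then 0 else \<infinity>)"
  proof (cases "\<forall>\<delta>>0. \<exists>v\<in>D. d v u < \<delta>")
    case True
    \<comment> \<open>Almost minimizing distance plus energy over \<open>D\<close> replaces a diagonal argument.\<close>
    define c where "c j v = d v u + e2ennreal (F (e j) v)" for j v
    define a where "a j = (INF v\<in>D. c j v)" for j
    have a_le: "a j \<le> c j v" if "v \<in> D" for j v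
      unfolding a_def using that by (rule INF_lower)
    have "\<exists>v\<in>D. c j v \<le> a j + ennreal (inverse (real (Suc j)))" for j
    proof (cases "a j = \<infinity>")
      case True
      obtain v where "v \<in> D" using \<open>\<forall>\<delta>>0. _\<close> zero_less_one by blast
      with True show ?thesis by auto
    next
      case False
      then have "a j < a j + ennreal (inverse (real (Suc j)))"
        by (cases "a j") (auto simp: ennreal_less_iff simp flip: ennreal_plus)
      then show ?thesis
        unfolding a_def INF_less_iff by (auto intro: less_imp_le)
    qed
    then obtain v where v: "\<And>j. v j \<in> D" "\<And>j. c j (v j) \<le> a j + ennreal (inverse (real (Suc j)))"
      by metis
    \<comment> \<open>Any fixed \<open>w\<close> in \<open>D\<close> close to \<open>u\<close>
      serves as competitor: its energy tends to zero, so \<open>c j w\<close> tends to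
      \<open>d w u\<close>, which is below \<open>\<delta>\<close>.\<close>
    have "a \<longlonglongrightarrow> 0"
    proof (rule order_tendstoI)
      fix \<delta> :: ennreal assume "0 < \<delta>"
      then obtain \<delta>' where \<delta>': "0 < \<delta>'" "\<delta>' < \<delta>" using dense by blast
      obtain w where w: "w \<in> D" "d w u < \<delta>'" using True \<delta>'(1) by blast
      have "filterlim e (at_right 0) sequentially"
        using e by (auto simp: filterlim_at less_imp_neq[symmetric])
      then have "(\<lambda>j. F (e j) w) \<longlonglongrightarrow> 0"
        by (rule filterlim_compose[OF vanish[OF w(1)]])
      then have "(\<lambda>j. c j w) \<longlonglongrightarrow> d w u + e2ennreal 0"
        unfolding c_def by (intro tendsto_add tendsto_const
            continuous_on_tendsto_compose[OF continuous_on_e2ennreal[of UNIV]]) auto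
      then have "\<forall>\<^sub>F j in sequentially. c j w < \<delta>"
        by (rule order_tendstoD(2)) (use w \<delta>' in \<open>auto simp: e2ennreal_neg intro: less_trans\<close>)
      then show "\<forall>\<^sub>F j in sequentially. a j < \<delta>"
        by eventually_elim (use a_le[OF w(1)] le_less_trans in blast)
    qed simp
    moreover have "(\<lambda>j. ennreal (inverse (real (Suc j)))) \<longlonglongrightarrow> ennreal 0"
      by (intro tendsto_ennrealI LIMSEQ_inverse_real_of_nat)
    ultimately have b: "(\<lambda>j. a j + ennreal (inverse (real (Suc j)))) \<longlonglongrightarrow> 0"
      using tendsto_add by fastforce
    have "(\<lambda>j. d (v j) u) \<longlonglongrightarrow> 0"
    proof (rule tendsto_sandwich[OF _ _ tendsto_const b])
      show "\<forall>\<^sub>F j in sequentially. d (v j) u \<le> a j + ennreal (inverse (real (Suc j)))"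
        using v(2) unfolding c_def
          by (intro always_eventually allI) (meson add_increasing2 order_trans order_refl zero_le)
    qed simp
    moreover have "(\<lambda>j. F (e j) (v j)) \<longlonglongrightarrow> 0"
    proof -
      have "(\<lambda>j. e2ennreal (F (e j) (v j))) \<longlonglongrightarrow> 0"
      proof (rule tendsto_sandwich[OF _ _ tendsto_const b])
        show "\<forall>\<^sub>F j in sequentially. e2ennreal (F (e j) (v j)) \<le> a j + ennreal (inverse (real (Suc j)))"
          using v(2) unfolding c_def
          by (intro always_eventually allI) (meson add_increasing order_trans order_refl zero_le)
      qed simp
      then have "(\<lambda>j. enn2ereal (e2ennreal (F (e j) (v j)))) \<longlonglongrightarrow> enn2ereal 0"
        by (rule tendsto_enn2erealI)
      moreover have "enn2ereal (e2ennreal (F (e j) (v j))) = F (e j) (v j)" for j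
        using nonneg[of "e j" "v j"] e v(1)[of j] assms(1) by (auto intro!: enn2ereal_e2ennreal)
      ultimately show ?thesis
        by (simp only: zero_ennreal.rep_eq)
    qed
    ultimately show ?thesis
      using True v(1) assms(1) by (intro exI[of _ v]) (auto simp: lim_imp_Limsup)
  next
    case False
    then show ?thesis using refl \<open>u \<in> X\<close> by (intro exI[of _ "\<lambda>_. u"]) auto
  qed
  fix v assume v: "(\<forall>j. v j \<in> X) \<and> (\<lambda>j. d (v j) u) \<longlonglongrightarrow> 0"
  show "(if \<forall>\<delta>>0. \<exists>v\<in>D. d v u < \<delta> then 0 else \<infinity>) \<le> liminf (\<lambda>j. F (e j) (v j))"
  proof (cases "\<forall>\<delta>>0. \<exists>v\<in>D. d v u < \<delta>")
    case True
    then show ?thesis using nonneg e v by (auto intro: Liminf_bounded)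
  next
    case False
    then obtain \<delta> where \<delta>: "0 < \<delta>" "\<And>v. v \<in> D \<Longrightarrow> \<not> d v u < \<delta>" by blast
    have "\<forall>\<^sub>F j in sequentially. d (v j) u < \<delta>"
      using v \<delta>(1) order_tendstoD(2) by blast
    then have "\<forall>\<^sub>F j in sequentially. \<infinity> \<le> F (e j) (v j)"
    proof eventually_elim
      case (elim j)
      then have "v j \<in> X - D" using \<delta>(2) v by blast
      then show ?case using infinite[of "e j" "v j"] e by simp
    qed
    then have "\<infinity> \<le> liminf (\<lambda>j. F (e j) (v j))"
      by (rule Liminf_bounded)
    then show ?thesis by simp
  qed
qed

text \<open>The zeroth limit is nonnegative and vanishes on \<open>D\<close>, so a single point of
  \<open>D\<close> makes its infimum zero and the first rescaling subtracts nothing. An empty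
  \<open>D\<close> would make the zeroth and then the first level infinite on all of
  \<open>X\<close>, against \<open>min1\<close>. For the domain only an inclusion is claimed, since
  the zeroth limit also vanishes at limit points of \<open>D\<close>.\<close>

lemma dev_level_one_of_finiteness_domain:
  fixes F :: "real \<Rightarrow> 'u \<Rightarrow> ereal"
  assumes D: "D \<subseteq> X" and nonneg: "\<And>e v. 0 < e \<Longrightarrow> v \<in> X \<Longrightarrow> 0 \<le> F e v"
    and vanish: "\<And>v. v \<in> D \<Longrightarrow> ((\<lambda>e. F e v) \<longlongrightarrow> 0) (at_right 0)"
    and infinite: "\<And>e v. 0 < e \<Longrightarrow> v \<in> X - D \<Longrightarrow> F e v = \<infinity>"
    and refl: "\<And>u. u \<in> X \<Longrightarrow> d u u = 0"
    and min1: "dev_min X d F 1 \<noteq> \<infinity>"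
  shows "dev_eps X d F 1 = (\<lambda>e u. F e u / ereal e) \<and> D \<subseteq> dev_dom X d F 1"
proof -
  define N where "N u = (if \<forall>\<delta>>0. \<exists>v\<in>D. d v u < \<delta> then 0 else (\<infinity>::ereal))" for u
  have lim0: "is_gamma_limit X d F N"
    unfolding is_gamma_limit_def N_def
  proof
    fix u assume "u \<in> X"
    then show "gamma_limit_at X d F u (if \<forall>\<delta>>0. \<exists>v\<in>D. d v u < \<delta> then 0 else \<infinity>)"
      using refl by (intro gamma_limit_at_finiteness_domain[OF D nonneg vanish infinite])
  qed
  have INF_N: "(INF v\<in>X. gamma_lim X d F v) = (INF v\<in>X. N v)"
    using gamma_lim_eq[OF lim0] by (intro INF_cong) auto
  have N0: "N u = 0" if "u \<in> D" for u
  proof -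
    have "d u u = 0" using that D refl by blast
    then have "\<forall>\<delta>>0. \<exists>v\<in>D. d v u < \<delta>" using that by (metis (no_types))
    then show ?thesis unfolding N_def by simp
  qed
  have "D \<noteq> {}"
  proof
    assume empty: "D = {}"
    have no_limit: "\<not> (\<forall>\<delta>>0::ennreal. \<exists>v\<in>{}. d v u < \<delta>)" for u
      using zero_less_one by blast
    then have "N u = \<infinity>" for u
      unfolding N_def empty by simp
    then have "(INF v\<in>X. gamma_lim X d F v) = \<infinity>"
      unfolding INF_N by (simp add: top_ereal_def[symmetric] cong: INF_cong)
    \<comment> \<open>Both terms of the difference are infinite here, and
      \<open>\<infinity> - \<infinity> = \<infinity>\<close> in \<open>ereal\<close>; dividing by a
      positive \<open>e\<close> keeps that value.\<close>
    then have eps1: "dev_eps X d F 1 e v = \<infinity>" if "0 < e" "v \<in> X" for e v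
      using infinite[OF that(1), of v] that empty by simp
    have "gamma_limit_at X d (dev_eps X d F 1) u
        (if \<forall>\<delta>>0. \<exists>v\<in>{}. d v u < \<delta> then 0 else \<infinity>)" if "u \<in> X" for u
      using eps1 refl[OF that] that
      by (intro gamma_limit_at_finiteness_domain) (simp_all del: dev_eps.simps)
    then have lim1: "is_gamma_limit X d (dev_eps X d F 1) (\<lambda>_. \<infinity>)"
      unfolding is_gamma_limit_def if_not_P[OF no_limit] by blast
    have "\<infinity> \<le> dev_min X d F 1"
      unfolding dev_min_def
    proof (rule INF_greatest)
      fix u assume "u \<in> dev_dom X d F 1"
      then have "u \<in> X" by simp
      then show "\<infinity> \<le> dev_lim X d F 1 u"
        using gamma_lim_eq[OF lim1] unfolding dev_lim_def by simp
    qed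
    with min1 show False by simp
  qed
  then obtain w where "w \<in> X" "N w = 0" using D N0 by blast
  then have "(INF v\<in>X. N v) \<le> 0" by (metis INF_lower)
  moreover have "0 \<le> (INF v\<in>X. N v)"
    by (rule INF_greatest) (simp add: N_def)
  ultimately have m0: "(INF v\<in>X. gamma_lim X d F v) = 0"
    unfolding INF_N by (rule antisym)
  then have "dev_eps X d F 1 = (\<lambda>e u. F e u / ereal e)"
    by (simp add: fun_eq_iff)
  moreover have "D \<subseteq> dev_dom X d F 1"
    using N0 D m0 gamma_lim_eq[OF lim0] by auto
  ultimately show ?thesis by blast
qed

section \<open>Limits that survive division by \<open>e\<close>\<close>

text \<open>This is the invariant handed from one level to the next. That \<open>G e\<close> itself
  vanishes at the zeros of \<open>L\<close>, for every positive \<open>e\<close>, is what keeps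
  constant sequences recovery sequences after division by \<open>e\<close>.\<close>

definition vanishing_limit ::
  "'u set \<Rightarrow> ('u \<Rightarrow> 'u \<Rightarrow> ennreal) \<Rightarrow> (real \<Rightarrow> 'u \<Rightarrow> ereal) \<Rightarrow> ('u \<Rightarrow> ereal) \<Rightarrow> bool"
  where "vanishing_limit X d G L \<longleftrightarrow> is_gamma_limit X d G L \<and> (\<forall>u\<in>X. 0 \<le> L u) \<and>
    (\<forall>e>0. \<forall>u\<in>X. 0 \<le> G e u \<and> (L u = 0 \<longrightarrow> G e u = 0))"

text \<open>At a zero of \<open>L\<close> the constant sequence keeps the value zero. Elsewhere the
  liminf inequality keeps \<open>G\<close> above a positive constant along every converging
  sequence, and division by \<open>e\<close> drives it to infinity. The term \<open>- 0\<close>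
  matches the shape of \<open>dev_eps\<close> once the subtracted minimum is known to be
  zero.\<close>

lemma vanishing_limit_rescale:
  assumes van: "vanishing_limit X d G L" and refl: "\<And>u. u \<in> X \<Longrightarrow> d u u = 0"
  shows "vanishing_limit X d (\<lambda>e v. (G e v - 0) / ereal e) (\<lambda>u. if L u = 0 then 0 else \<infinity>)"
proof -
  have lim: "is_gamma_limit X d G L"
    and nonneg: "\<And>e v. 0 < e \<Longrightarrow> v \<in> X \<Longrightarrow> 0 \<le> G e v"
    and Lnonneg: "\<And>u. u \<in> X \<Longrightarrow> 0 \<le> L u"
    and zero: "\<And>e u. 0 < e \<Longrightarrow> u \<in> X \<Longrightarrow> L u = 0 \<Longrightarrow> G e u = 0"
    using van unfolding vanishing_limit_def by auto
  have "is_gamma_limit X d (\<lambda>e v. (G e v - 0) / ereal e) (\<lambda>u. if L u = 0 then 0 else \<infinity>)"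
    unfolding is_gamma_limit_def
  proof
    fix u assume u: "u \<in> X"
    show "gamma_limit_at X d (\<lambda>e v. (G e v - 0) / ereal e) u (if L u = 0 then 0 else \<infinity>)"
      unfolding gamma_limit_at_def
    proof (intro allI impI conjI)
      fix e :: "nat \<Rightarrow> real" assume e: "(\<forall>j. 0 < e j) \<and> decseq e \<and> e \<longlonglongrightarrow> 0"
      show "\<exists>v. (\<forall>j. v j \<in> X) \<and> (\<lambda>j. d (v j) u) \<longlonglongrightarrow> 0 \<and>
        limsup (\<lambda>j. (G (e j) (v j) - 0) / ereal (e j)) \<le> (if L u = 0 then 0 else \<infinity>)"
        using e u refl[OF u] zero[OF _ u]
        by (intro exI[of _ "\<lambda>_. u"]) (auto simp: Limsup_const)
      fix v assume v: "(\<forall>j. v j \<in> X) \<and> (\<lambda>j. d (v j) u) \<longlonglongrightarrow> 0"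
      have ge0: "0 \<le> (G (e j) (v j) - 0) / ereal (e j)" for j
        using nonneg[of "e j" "v j"] e v by (simp add: zero_le_divide_ereal less_imp_le)
      show "(if L u = 0 then 0 else \<infinity>) \<le> liminf (\<lambda>j. (G (e j) (v j) - 0) / ereal (e j))"
      proof (cases "L u = 0")
        case True
        then show ?thesis using ge0 by (auto intro: Liminf_bounded)
      next
        case False
        then have "0 < L u" using Lnonneg[OF u] by auto
        then obtain c where c: "0 < ereal c" "ereal c < L u"
          using ereal_dense2 by blast
        have "L u \<le> liminf (\<lambda>j. G (e j) (v j))"
          using lim u e v unfolding is_gamma_limit_def gamma_limit_at_def by blast
        with c have ev: "\<forall>\<^sub>F j in sequentially. ereal c < G (e j) (v j)"
          unfolding le_Liminf_iff by blast
        have "\<forall>\<^sub>F j in sequentially. ereal B < (G (e j) (v j) - 0) / ereal (e j)" for B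
        proof -
          \<comment> \<open>The denominator \<open>\<bar>B\<bar> + 1\<close> is positive and at
            least \<open>B\<close>, so this threshold gives \<open>B * e j < c\<close> for
            \<open>B\<close> of either sign.\<close>
          have "\<forall>\<^sub>F j in sequentially. e j < c / (\<bar>B\<bar> + 1)"
            using e c by (intro order_tendstoD(2)[of e 0]) auto
          with ev show ?thesis
          proof eventually_elim
            case (elim j)
            have ej: "0 < e j" using e by blast
            have "B * e j < c"
            proof -
              have "B * e j \<le> (\<bar>B\<bar> + 1) * e j" using ej by (intro mult_right_mono) auto
              also have "\<dots> < c" using elim(2) by (simp add: field_simps)
              finally show ?thesis .
            qed
            then have "ereal B * ereal (e j) < G (e j) (v j)"
              using elim(1) by (metis less_ereal.simps(1) less_trans times_ereal.simps(1))
            then show ?case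
              using ej by (cases "G (e j) (v j)") (auto simp: field_simps)
          qed
        qed
        then have "(\<lambda>j. (G (e j) (v j) - 0) / ereal (e j)) \<longlonglongrightarrow> \<infinity>"
          unfolding tendsto_PInfty by blast
        then show ?thesis
          by (simp add: lim_imp_Liminf)
      qed
    qed
  qed
  then show ?thesis
    using nonneg zero unfolding vanishing_limit_def by auto
qed

text \<open>This turns the sequential liminf inequality into a uniform bound on a neighbourhood. If
  every choice of \<open>\<delta>\<close> and \<open>e\<close> failed, the choices
  \<open>1 / (j + 1)\<close> for both at once would give a sequence converging to \<open>u\<close>
  with energies tending to at most zero, against \<open>0 < l\<close>.\<close>

lemma gamma_limit_at_pos_bound:
  assumes "gamma_limit_at X d G u l" "0 < l"
  obtains \<delta> e :: real where "0 < \<delta>" "0 < e"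
    "\<And>v. v \<in> X \<Longrightarrow> d v u < ennreal \<delta> \<Longrightarrow> ereal \<delta> < G e v"
proof (rule ccontr)
  define e :: "nat \<Rightarrow> real" where "e = (\<lambda>j. inverse (real (Suc j)))"
  have e: "\<forall>j. 0 < e j" "decseq e" "e \<longlonglongrightarrow> 0"
    unfolding e_def using LIMSEQ_inverse_real_of_nat by (auto simp: decseq_def field_simps)
  assume "\<not> thesis"
  then have "\<exists>v. v \<in> X \<and> d v u < ennreal (e j) \<and> G (e j) v \<le> ereal (e j)" for j
    using that[of "e j" "e j"] e(1) by (meson not_less)
  then obtain v where v: "\<And>j. v j \<in> X" "\<And>j. d (v j) u < ennreal (e j)"
    "\<And>j. G (e j) (v j) \<le> ereal (e j)"
    by metis
  have "(\<lambda>j. d (v j) u) \<longlonglongrightarrow> 0"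
  proof (rule tendsto_sandwich[OF _ _ tendsto_const])
    show "(\<lambda>j. ennreal (e j)) \<longlonglongrightarrow> 0"
      using tendsto_ennrealI[OF e(3)] by simp
  qed (use v(2) in \<open>auto simp: less_imp_le\<close>)
  then have "l \<le> liminf (\<lambda>j. G (e j) (v j))"
    using assms(1) v(1) e unfolding gamma_limit_at_def by blast
  also have "\<dots> \<le> liminf (\<lambda>j. ereal (e j))"
    using v(3) by (intro Liminf_mono) auto
  also have "\<dots> = 0"
    using e(3) by (intro lim_imp_Liminf) (auto simp: zero_ereal_def)
  finally show False using assms(2) by simp
qed

text \<open>A zero of the nonnegative \<open>L\<close> inside the current domain makes the minimum
  zero. The recursion then subtracts zero and is an instance of
  \<open>vanishing_limit_rescale\<close>.\<close>

lemma vanishing_limit_dev_Suc: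
  fixes F :: "real \<Rightarrow> 'u \<Rightarrow> ereal"
  assumes van: "vanishing_limit X d (dev_eps X d F m) L"
    and sub: "dev_dom X d F m \<subseteq> X" and attained: "\<exists>u\<in>dev_dom X d F m. L u = 0"
    and refl: "\<And>u. u \<in> X \<Longrightarrow> d u u = 0"
  shows "dev_min X d F m = 0"
    and "dev_dom X d F (Suc m) = {u \<in> dev_dom X d F m. L u = 0}"
    and "vanishing_limit X d (dev_eps X d F (Suc m)) (\<lambda>u. if L u = 0 then 0 else \<infinity>)"
proof -
  have L: "gamma_lim X d (dev_eps X d F m) u = L u" if "u \<in> dev_dom X d F m" for u
    using van sub that unfolding vanishing_limit_def by (blast intro: gamma_lim_eq)
  have "(INF v\<in>dev_dom X d F m. gamma_lim X d (dev_eps X d F m) v)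
      = (INF v\<in>dev_dom X d F m. L v)"
    using L by (intro INF_cong) auto
  also have "\<dots> = 0"
    using van sub attained unfolding vanishing_limit_def
    by (intro antisym INF_greatest) (auto intro: INF_lower2)
  finally have m: "(INF v\<in>dev_dom X d F m. gamma_lim X d (dev_eps X d F m) v) = 0" .
  then show "dev_min X d F m = 0"
    by (simp add: dev_min_def dev_lim_def)
  show "dev_dom X d F (Suc m) = {u \<in> dev_dom X d F m. L u = 0}"
    using L m by auto
  show "vanishing_limit X d (dev_eps X d F (Suc m)) (\<lambda>u. if L u = 0 then 0 else \<infinity>)"
    using vanishing_limit_rescale[OF van refl] m by simp
qed

text \<open>The domain at level \<open>k\<close> is known only up to lying between the zero set of
  \<open>L\<close> and \<open>X\<close>. One step of the recursion cuts it down to exactly that zero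
  set, and from then on domain and limit reproduce themselves.\<close>

lemma dev_stationary:
  fixes F :: "real \<Rightarrow> 'u \<Rightarrow> ereal"
  assumes van: "vanishing_limit X d (dev_eps X d F k) L"
    and dom: "{u \<in> X. L u = 0} \<subseteq> dev_dom X d F k" "dev_dom X d F k \<subseteq> X"
    and ne: "\<exists>u\<in>X. L u = 0"
    and refl: "\<And>u. u \<in> X \<Longrightarrow> d u u = 0"
    and "k < m"
  shows "is_gamma_limit X d (dev_eps X d F m) (\<lambda>u. if L u = 0 then 0 else \<infinity>)"
    and "dev_min X d F m = 0"
    and "dev_set X d F m = {u \<in> X. L u = 0}"
    and "dev_set X d F k = {u \<in> X. L u = 0}"
proof -
  let ?M = "\<lambda>u. if L u = 0 then 0 else (\<infinity> :: ereal)"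
  \<comment> \<open>Rescaling replaces a limit by the function that is zero on its zero set and
    infinite elsewhere. \<open>?M\<close> is a fixed point of this operation, so all later limits
    coincide.\<close>
  have MM: "(\<lambda>u. if ?M u = 0 then 0 else \<infinity>) = ?M" by auto
  have k: "dev_dom X d F (Suc k) = {u \<in> X. L u = 0}" "vanishing_limit X d (dev_eps X d F (Suc k)) ?M"
    using vanishing_limit_dev_Suc[OF van dom(2) _ refl] dom ne by blast+
  have "Suc k \<le> m" using \<open>k < m\<close> by simp
  then have m: "dev_dom X d F m = {u \<in> X. L u = 0} \<and> vanishing_limit X d (dev_eps X d F m) ?M"
  proof (induction m rule: dec_induct)
    case base
    show ?case using k by simp
  next
    case (step m)
    have *: "\<exists>u\<in>dev_dom X d F m. ?M u = 0" "dev_dom X d F m \<subseteq> X"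
      using step.IH ne by auto
    show ?case
      using vanishing_limit_dev_Suc(2,3)[OF conjunct2[OF step.IH] *(2,1) refl] step.IH MM
      by (auto simp del: dev_dom.simps dev_eps.simps split: if_splits)
  qed
  have *: "\<exists>u\<in>dev_dom X d F m. ?M u = 0" "dev_dom X d F m \<subseteq> X"
    using m ne by auto
  show "is_gamma_limit X d (dev_eps X d F m) ?M"
    using m unfolding vanishing_limit_def by blast
  show "dev_min X d F m = 0"
    using vanishing_limit_dev_Suc(1)[OF conjunct2[OF m] *(2,1) refl] .
  show "dev_set X d F m = {u \<in> X. L u = 0}"
    using vanishing_limit_dev_Suc(2)[OF conjunct2[OF m] *(2,1) refl] m
    unfolding dev_set_def by auto
  show "dev_set X d F k = {u \<in> X. L u = 0}"
    unfolding dev_set_def by (rule k)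
qed

section \<open>Lebesgue measure on products\<close>

text \<open>A Lebesgue set is a Borel set up to a null set; Borel measurability handles the first
  part and \<open>null\<close> the second. It is applied to the projections, because
  \<open>Q_energy\<close> integrates over the completed measure on pairs.\<close>

lemma measurable_lebesgue_of_null_vimage:
  fixes f :: "'a::euclidean_space \<Rightarrow> 'b::euclidean_space"
  assumes [measurable]: "f \<in> borel_measurable borel"
    and null: "\<And>N. N \<in> null_sets lborel \<Longrightarrow> f -` N \<in> null_sets lborel"
  shows "f \<in> lebesgue \<rightarrow>\<^sub>M lebesgue"
proof (rule completion.measurable_completion2)
  show f: "f \<in> lebesgue \<rightarrow>\<^sub>M lborel"
    by (simp add: measurable_completion)
  show "null_sets lborel \<subseteq> null_sets (distr lebesgue lborel f)"
  proof
    fix N :: "'b set" assume N: "N \<in> null_sets lborel"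
    then have "f -` N \<in> null_sets lebesgue"
      by (intro null_sets_completionI null)
    then show "N \<in> null_sets (distr lebesgue lborel f)"
      using N f by (auto simp: null_sets_def emeasure_distr)
  qed
qed

lemma AE_lebesgue_of_null_vimage:
  fixes f :: "'a::euclidean_space \<Rightarrow> 'b::euclidean_space"
  assumes null: "\<And>N. N \<in> null_sets lborel \<Longrightarrow> f -` N \<in> null_sets lborel"
    and "AE x in lebesgue. P x"
  shows "AE x in lebesgue. P (f x)"
proof -
  from assms(2) obtain N where "N \<in> null_sets lebesgue" "{x. \<not> P x} \<subseteq> N"
    unfolding eventually_ae_filter by auto
  then obtain N' where "N' \<in> null_sets lborel" "{x. \<not> P x} \<subseteq> N'"
    unfolding null_sets_completion_iff2 by auto
  then have "f -` N' \<in> null_sets lebesgue" "{x. \<not> P (f x)} \<subseteq> f -` N'"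
    by (auto intro: null_sets_completionI null)
  then show ?thesis
    unfolding eventually_ae_filter by auto
qed

text \<open>The preimage is a cylinder over \<open>N\<close>, of measure
  \<open>0 * \<infinity> = 0\<close> in \<open>ennreal\<close>. Properties holding almost everywhere
  in one variable thus hold for almost every pair.\<close>

lemma vimage_fst_null_sets_lborel:
  fixes N :: "'a::euclidean_space set"
  assumes "N \<in> null_sets lborel"
  shows "fst -` N \<in> null_sets (lborel :: ('a \<times> 'b::euclidean_space) measure)"
proof -
  have "N \<times> (UNIV :: 'b set) \<in> null_sets (lborel \<Otimes>\<^sub>M lborel)"
    using assms by (auto simp: null_sets_def lborel.emeasure_pair_measure_Times)
  then show ?thesis
    by (simp add: lborel_prod vimage_fst)
qed

lemma vimage_snd_null_sets_lborel:
  fixes N :: "'b::euclidean_space set"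
  assumes "N \<in> null_sets lborel"
  shows "snd -` N \<in> null_sets (lborel :: ('a::euclidean_space \<times> 'b) measure)"
proof -
  have "(UNIV :: 'a set) \<times> N \<in> null_sets (lborel \<Otimes>\<^sub>M lborel)"
    using assms by (auto simp: null_sets_def lborel.emeasure_pair_measure_Times)
  then show ?thesis
    by (simp add: lborel_prod vimage_snd)
qed

lemma AE_lebesgue_fst:
  fixes P :: "'a::euclidean_space \<Rightarrow> bool"
  assumes "AE x in lebesgue. P x"
  shows "AE p in (lebesgue :: ('a \<times> 'b::euclidean_space) measure). P (fst p)"
  using vimage_fst_null_sets_lborel assms by (rule AE_lebesgue_of_null_vimage)

lemma AE_lebesgue_snd:
  fixes P :: "'b::euclidean_space \<Rightarrow> bool"
  assumes "AE x in lebesgue. P x"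
  shows "AE p in (lebesgue :: ('a::euclidean_space \<times> 'b) measure). P (snd p)"
  using vimage_snd_null_sets_lborel assms by (rule AE_lebesgue_of_null_vimage)

lemma measurable_fst_lebesgue [measurable]:
  "fst \<in> (lebesgue :: ('a::euclidean_space \<times> 'b::euclidean_space) measure) \<rightarrow>\<^sub>M lebesgue"
  by (intro measurable_lebesgue_of_null_vimage vimage_fst_null_sets_lborel)
    (rule borel_measurable_continuous_onI[OF continuous_on_fst[OF continuous_on_id]])

lemma measurable_snd_lebesgue [measurable]:
  "snd \<in> (lebesgue :: ('a::euclidean_space \<times> 'b::euclidean_space) measure) \<rightarrow>\<^sub>M lebesgue"
  by (intro measurable_lebesgue_of_null_vimage vimage_snd_null_sets_lborel)
    (rule borel_measurable_continuous_onI[OF continuous_on_snd[OF continuous_on_id]])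

text \<open>The bound passes to the Borel main parts of \<open>A\<close> and \<open>B\<close>: they
  have the same measures, their product is measured by the uncompleted product measure, and it is
  contained in \<open>A \<times> B\<close>.\<close>

lemma
  fixes A :: "'a::euclidean_space set" and B :: "'b::euclidean_space set"
  assumes "A \<in> sets lebesgue" "B \<in> sets lebesgue"
  shows sets_lebesgue_Times: "A \<times> B \<in> sets lebesgue"
    and emeasure_lebesgue_Times_ge:
      "emeasure lebesgue A * emeasure lebesgue B \<le> emeasure lebesgue (A \<times> B)"
proof -
  have "A \<times> B = fst -` A \<inter> snd -` B" by auto
  then show *: "A \<times> B \<in> sets lebesgue"
    using measurable_sets[OF measurable_fst_lebesgue assms(1)]
      measurable_sets[OF measurable_snd_lebesgue assms(2)] by auto
  let ?A = "main_part lborel A" and ?B = "main_part lborel B"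
  have m: "?A \<in> sets lborel" "?B \<in> sets lborel"
    using assms by (blast intro: main_part_sets)+
  then have mp: "?A \<times> ?B \<in> sets (lborel \<Otimes>\<^sub>M lborel)" by (rule pair_measureI)
  have sub: "?A \<subseteq> A" "?B \<subseteq> B" using assms main_part_null_part_Un by blast+
  have "emeasure lebesgue A * emeasure lebesgue B = emeasure lborel ?A * emeasure lborel ?B"
    using assms by simp
  also have "\<dots> = emeasure (lborel \<Otimes>\<^sub>M lborel) (?A \<times> ?B)"
    using m by (simp add: lborel.emeasure_pair_measure_Times)
  also have "\<dots> = emeasure lebesgue (?A \<times> ?B)"
    using mp unfolding lborel_prod by simp
  also have "\<dots> \<le> emeasure lebesgue (A \<times> B)"
    using sub * by (intro emeasure_mono) auto
  finally show "emeasure lebesgue A * emeasure lebesgue B \<le> emeasure lebesgue (A \<times> B)" .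
qed

section \<open>The nonlocal double-well energy\<close>

lemma Xg_iff:
  "u \<in> Xg \<Omega> g \<longleftrightarrow> u \<in> borel_measurable lebesgue \<and> (\<forall>x. \<bar>u x\<bar> \<le> 1) \<and> (\<forall>x. x \<notin> \<Omega> \<longrightarrow> u x = g x)"
  by (auto simp: Xg_def abs_le_iff)

lemma Q_density_measurable:
  fixes u :: "real ^ 'n \<Rightarrow> real"
  assumes "open \<Omega>" and [measurable]: "u \<in> borel_measurable lebesgue"
  shows "(\<lambda>p. ennreal (\<bar>u (fst p) - u (snd p)\<bar>\<^sup>2 / norm (fst p - snd p) powr a)
    * indicator (Q_set \<Omega>) p) \<in> borel_measurable lebesgue"
proof -
  have "Q_set \<Omega> = - ((- \<Omega>) \<times> (- \<Omega>))"
    unfolding Q_set_def by auto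
  then have "open (Q_set \<Omega>)"
    using assms(1) by (auto intro!: closed_Times)
  then have [measurable]: "Q_set \<Omega> \<in> sets lebesgue" by auto
  have "(\<lambda>p::(real^'n) \<times> (real^'n). norm (fst p - snd p) powr a) \<in> borel_measurable lborel"
  proof -
    have [measurable]: "(\<lambda>p::(real^'n) \<times> (real^'n). norm (fst p - snd p)) \<in> borel_measurable borel"
      by (intro borel_measurable_continuous_onI continuous_intros)
    show ?thesis by simp
  qed
  then have [measurable]: "(\<lambda>p::(real^'n) \<times> (real^'n). norm (fst p - snd p) powr a) \<in> borel_measurable lebesgue"
    by (rule measurable_completion)
  show ?thesis by measurable
qed

text \<open>This is Fatou's lemma on pairs, after transferring the almost everywhere convergence to
  both coordinates.\<close>

lemma Q_energy_lower_semicontinuous: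
  fixes u :: "real ^ 'n \<Rightarrow> real"
  assumes "open \<Omega>" and [measurable]: "u \<in> borel_measurable lebesgue" "\<And>j. v j \<in> borel_measurable lebesgue"
    and lim: "AE x in lebesgue. (\<lambda>j. v j x) \<longlonglongrightarrow> u x"
  shows "Q_energy \<Omega> s u \<le> liminf (\<lambda>j. Q_energy \<Omega> s (v j))"
proof -
  let ?f = "\<lambda>u p. ennreal (\<bar>u (fst p) - u (snd p)\<bar>\<^sup>2 / norm (fst p - snd p) powr (real CARD('n) + 2 * s))
    * indicator (Q_set \<Omega>) (p :: (real^'n) \<times> (real^'n))"
  have "AE p in lebesgue. ?f u p = liminf (\<lambda>j. ?f (v j) p)"
    using AE_lebesgue_fst[OF lim] AE_lebesgue_snd[OF lim]
  proof eventually_elim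
    case (elim p)
    \<comment> \<open>Multiplying by the constant inverse covers the diagonal too, where the
      denominator is zero and its inverse is zero by convention.\<close>
    have "(\<lambda>j. \<bar>v j (fst p) - v j (snd p)\<bar>\<^sup>2 * inverse (norm (fst p - snd p) powr (real CARD('n) + 2 * s)))
      \<longlonglongrightarrow> \<bar>u (fst p) - u (snd p)\<bar>\<^sup>2 * inverse (norm (fst p - snd p) powr (real CARD('n) + 2 * s))"
      by (intro tendsto_intros elim)
    then have "(\<lambda>j. ?f (v j) p) \<longlonglongrightarrow> ?f u p"
      by (intro tendsto_mult_ennreal tendsto_const tendsto_ennrealI)
        (auto simp: divide_inverse indicator_def)
    then show ?case
      by (simp add: lim_imp_Liminf)
  qed
  then have "Q_energy \<Omega> s u = (\<integral>\<^sup>+p. liminf (\<lambda>j. ?f (v j) p) \<partial>lebesgue)"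
    unfolding Q_energy_def by (rule nn_integral_cong_AE)
  also have "\<dots> \<le> liminf (\<lambda>j. \<integral>\<^sup>+p. ?f (v j) p \<partial>lebesgue)"
    by (intro nn_integral_liminf Q_density_measurable assms)
  finally show ?thesis unfolding Q_energy_def .
qed

lemma double_well_nonneg:
  assumes "double_well W" "\<bar>t\<bar> \<le> 1"
  shows "0 \<le> W t" "W t = 0 \<longleftrightarrow> t = 1 \<or> t = -1"
proof -
  have "t = 1 \<or> t = -1 \<or> t \<in> {-1<..<1}" using assms(2) by auto
  moreover have "W 1 = 0" "W (-1) = 0" "t \<in> {-1<..<1} \<longrightarrow> 0 < W t"
    using assms(1) unfolding double_well_def by auto
  ultimately show "0 \<le> W t" "W t = 0 \<longleftrightarrow> t = 1 \<or> t = -1"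
    by force+
qed

text \<open>\<open>W\<close> is continuous only on \<open>{-1..1}\<close>. Truncating the argument
  extends it continuously to the line without changing \<open>W (u x)\<close>.\<close>

lemma well_measurable:
  assumes "double_well W" and "u \<in> borel_measurable M" and "\<And>x. \<bar>u x\<bar> \<le> 1"
  shows "(\<lambda>x. W (u x)) \<in> borel_measurable M"
proof -
  have "continuous_on UNIV (\<lambda>t. W (max (-1) (min 1 t)))"
  proof (rule continuous_on_compose2[of "{-1..1}" W UNIV "\<lambda>t. max (-1) (min 1 t)"])
    show "continuous_on {-1..1} W" using assms(1) unfolding double_well_def by blast
  qed (auto intro!: continuous_intros)
  then have "(\<lambda>t. W (max (-1) (min 1 t))) \<in> borel_measurable borel"
    by (rule borel_measurable_continuous_onI)
  with assms(2) have "(\<lambda>x. W (max (-1) (min 1 (u x)))) \<in> borel_measurable M"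
    by (rule measurable_compose)
  moreover have "max (-1) (min 1 (u x)) = u x" for x
    using assms(3)[of x] by linarith
  ultimately show ?thesis by simp
qed

lemma well_energy_lower_semicontinuous:
  fixes u :: "'a::euclidean_space \<Rightarrow> real"
  assumes W: "double_well W" and \<Omega>: "\<Omega> \<in> sets lebesgue"
    and v: "\<And>j. v j \<in> borel_measurable lebesgue" "\<And>j x. \<bar>v j x\<bar> \<le> 1"
    and u: "\<And>x. \<bar>u x\<bar> \<le> 1"
    and lim: "AE x in lebesgue. (\<lambda>j. v j x) \<longlonglongrightarrow> u x"
  shows "(\<integral>\<^sup>+x\<in>\<Omega>. ennreal (W (u x)) \<partial>lebesgue)
    \<le> liminf (\<lambda>j. \<integral>\<^sup>+x\<in>\<Omega>. ennreal (W (v j x)) \<partial>lebesgue)"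
proof -
  have "AE x in lebesgue. ennreal (W (u x)) * indicator \<Omega> x
      = liminf (\<lambda>j. ennreal (W (v j x)) * indicator \<Omega> x)"
    using lim
  proof eventually_elim
    case (elim x)
    have "(\<lambda>j. W (v j x)) \<longlonglongrightarrow> W (u x)"
      using W u v(2) unfolding double_well_def
      by (intro continuous_on_tendsto_compose[of "{-1..1}" W _ _ sequentially, OF _ elim])
        (auto simp: abs_le_iff minus_le_iff)
    then have "(\<lambda>j. ennreal (W (v j x)) * indicator \<Omega> x) \<longlonglongrightarrow> ennreal (W (u x)) * indicator \<Omega> x"
      by (intro tendsto_mult_ennreal tendsto_const tendsto_ennrealI) (auto simp: indicator_def)
    then show ?case
      by (simp add: lim_imp_Liminf)
  qed
  then have "(\<integral>\<^sup>+x\<in>\<Omega>. ennreal (W (u x)) \<partial>lebesgue)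
      = (\<integral>\<^sup>+x. liminf (\<lambda>j. ennreal (W (v j x)) * indicator \<Omega> x) \<partial>lebesgue)"
    by (rule nn_integral_cong_AE)
  also have "\<dots> \<le> liminf (\<lambda>j. \<integral>\<^sup>+x\<in>\<Omega>. ennreal (W (v j x)) \<partial>lebesgue)"
  proof (rule nn_integral_liminf)
    note [measurable] = well_measurable[OF W v] \<Omega>
    show "(\<lambda>x. ennreal (W (v j x)) * indicator \<Omega> x) \<in> borel_measurable lebesgue" for j
      by measurable
  qed
  finally show ?thesis .
qed

text \<open>Members of \<open>Xg \<Omega> g\<close> agree outside \<open>\<Omega>\<close>, so the
  distance is the norm of \<open>L1\<close> on the whole space; boundedness of
  \<open>\<Omega>\<close> makes the differences integrable. The convergence then holds almost
  everywhere on the whole space, as the nonlocal energy requires.\<close>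

lemma L1_dist_AE_subseq:
  assumes \<Omega>: "open \<Omega>" "bounded \<Omega>" and v: "\<And>j. v j \<in> Xg \<Omega> g" and u: "u \<in> Xg \<Omega> g"
    and lim: "(\<lambda>j. L1_dist \<Omega> (v j) u) \<longlonglongrightarrow> 0"
  obtains r :: "nat \<Rightarrow> nat" where "strict_mono r" "AE x in lebesgue. (\<lambda>j. v (r j) x) \<longlonglongrightarrow> u x"
proof -
  have fin: "emeasure lebesgue \<Omega> < \<infinity>"
    using lmeasurable_open[OF \<Omega>(2,1)] by (auto simp: fmeasurable_def)
  have [measurable]: "u \<in> borel_measurable lebesgue" "v j \<in> borel_measurable lebesgue" for j
    using u v by (auto simp: Xg_iff)
  have eq: "L1_dist \<Omega> (v j) u = (\<integral>\<^sup>+x. ennreal (norm (v j x - u x)) \<partial>lebesgue)" for j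
    using u v unfolding L1_dist_def by (intro nn_integral_cong) (auto simp: Xg_iff indicator_def)
  have "L1_dist \<Omega> (v j) u \<le> (\<integral>\<^sup>+x. 2 * indicator \<Omega> x \<partial>lebesgue)" for j
    unfolding L1_dist_def
  proof (rule nn_integral_mono)
    fix x
    have "\<bar>v j x - u x\<bar> \<le> 2"
      using abs_triangle_ineq4[of "v j x" "u x"] u v[of j] unfolding Xg_iff
      by (metis add_mono one_add_one order_trans)
    then have "ennreal \<bar>v j x - u x\<bar> \<le> ennreal 2" by (rule ennreal_leI)
    then show "ennreal \<bar>v j x - u x\<bar> * indicator \<Omega> x \<le> 2 * indicator \<Omega> x"
      by (intro mult_right_mono) auto
  qed
  also have "(\<integral>\<^sup>+x. 2 * indicator \<Omega> x \<partial>lebesgue) < \<infinity>"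
    using fin \<Omega>(1) by (subst nn_integral_cmult_indicator) (auto simp: ennreal_mult_less_top)
  finally have int: "integrable lebesgue (\<lambda>x. v j x - u x)" for j
    unfolding eq by (intro integrableI_bounded) auto
  then have "L1_dist \<Omega> (v j) u = ennreal (\<integral>x. norm (v j x - u x) \<partial>lebesgue)" for j
    unfolding eq by (intro nn_integral_eq_integral integrable_norm) auto
  with lim have "(\<lambda>j. ennreal (\<integral>x. norm (v j x - u x) \<partial>lebesgue)) \<longlonglongrightarrow> ennreal 0"
    by simp
  then have "(\<lambda>j. \<integral>x. norm (v j x - u x) \<partial>lebesgue) \<longlonglongrightarrow> 0"
    by (subst (asm) tendsto_ennreal_iff) auto
  from tendsto_L1_AE_subseq[OF int this] show thesis
    using that unfolding LIM_zero_iff by blast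
qed

section \<open>The first-order limit\<close>

definition well_energy :: "(real ^ 'n) set \<Rightarrow> (real \<Rightarrow> real) \<Rightarrow> (real ^ 'n \<Rightarrow> real) \<Rightarrow> ennreal"
  where "well_energy \<Omega> W u = (\<integral>\<^sup>+x\<in>\<Omega>. ennreal (W (u x)) \<partial>lebesgue)"

lemma F_eps_rescaled:
  assumes "0 < e"
  shows "F_eps \<Omega> s W e u / ereal e
    = enn2ereal (Q_energy \<Omega> s u + ennreal (e powr (- (2 * s))) * well_energy \<Omega> W u)"
proof -
  have "e powr (1 - 2 * s) = e * e powr (- (2 * s))"
    using assms by (simp add: powr_diff powr_minus divide_inverse)
  then have "F_eps \<Omega> s W e u
    = enn2ereal (ennreal e * (Q_energy \<Omega> s u + ennreal (e powr (- (2 * s))) * well_energy \<Omega> W u))"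
    using assms by (simp add: F_eps_def well_energy_def distrib_left ennreal_mult mult.assoc)
  then show ?thesis
    using assms
    by (cases "Q_energy \<Omega> s u + ennreal (e powr (- (2 * s))) * well_energy \<Omega> W u")
      (auto simp: ennreal_mult_top simp flip: ennreal_mult)
qed

text \<open>For \<open>u\<close> in \<open>Xg \<Omega> g\<close>, zero well energy means
  \<open>u = 1\<close> or \<open>u = -1\<close> almost everywhere in \<open>\<Omega>\<close>.
  Constant sequences are recovery sequences: with zero well energy the quotient equals the nonlocal
  energy for every \<open>e\<close>. The liminf inequality is Fatou's lemma, with the factor
  \<open>e powr (- (2 * s))\<close> penalizing positive well energy.\<close>

lemma first_gamma_limit:
  fixes \<Omega> :: "(real ^ 'n) set"
  assumes \<Omega>: "open \<Omega>" "bounded \<Omega>" and W: "double_well W" and s: "0 < s"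
  shows "vanishing_limit (Xg \<Omega> g) (L1_dist \<Omega>) (\<lambda>e u. F_eps \<Omega> s W e u / ereal e)
    (\<lambda>u. if well_energy \<Omega> W u = 0 then enn2ereal (Q_energy \<Omega> s u) else \<infinity>)"
proof -
  let ?L = "\<lambda>u. if well_energy \<Omega> W u = 0 then enn2ereal (Q_energy \<Omega> s u) else \<infinity>"
  have "is_gamma_limit (Xg \<Omega> g) (L1_dist \<Omega>) (\<lambda>e u. F_eps \<Omega> s W e u / ereal e) ?L"
    unfolding is_gamma_limit_def gamma_limit_at_def
  proof (intro ballI allI impI conjI)
    fix u and e :: "nat \<Rightarrow> real"
    assume u: "u \<in> Xg \<Omega> g" and e: "(\<forall>j. 0 < e j) \<and> decseq e \<and> e \<longlonglongrightarrow> 0"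
    then have e0: "\<And>j. 0 < e j" and elim: "e \<longlonglongrightarrow> 0" by auto
    show "\<exists>v. (\<forall>j. v j \<in> Xg \<Omega> g) \<and> (\<lambda>j. L1_dist \<Omega> (v j) u) \<longlonglongrightarrow> 0 \<and>
        limsup (\<lambda>j. F_eps \<Omega> s W (e j) (v j) / ereal (e j)) \<le> ?L u"
      using u e0 by (intro exI[of _ "\<lambda>_. u"]) (auto simp: F_eps_rescaled L1_dist_def Limsup_const)
    fix v assume v: "(\<forall>j. v j \<in> Xg \<Omega> g) \<and> (\<lambda>j. L1_dist \<Omega> (v j) u) \<longlonglongrightarrow> 0"
    define G where "G = (\<lambda>j. F_eps \<Omega> s W (e j) (v j) / ereal (e j))"
    have G: "G j = enn2ereal (Q_energy \<Omega> s (v j) + ennreal (e j powr (- (2 * s))) * well_energy \<Omega> W (v j))" for j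
      unfolding G_def by (rule F_eps_rescaled[OF e0])
    \<comment> \<open>The first subsequence realizes the liminf and the second gives convergence
      almost everywhere, so bounds along the combined \<open>q\<close> are bounds for the liminf of
      the full sequence.\<close>
    obtain r where r: "strict_mono r" "(G \<circ> r) \<longlonglongrightarrow> liminf G"
      using liminf_subseq_lim by blast
    have "(\<lambda>j. L1_dist \<Omega> (v (r j)) u) \<longlonglongrightarrow> 0"
      using LIMSEQ_subseq_LIMSEQ[OF conjunct2[OF v] r(1)] by (simp add: o_def)
    then obtain r' where r': "strict_mono r'" "AE x in lebesgue. (\<lambda>j. v (r (r' j)) x) \<longlonglongrightarrow> u x"
      using L1_dist_AE_subseq[OF \<Omega>, of "\<lambda>j. v (r j)" g u] u v by blast
    define q where "q = r \<circ> r'"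
    have q: "strict_mono q" "AE x in lebesgue. (\<lambda>j. v (q j) x) \<longlonglongrightarrow> u x"
      using r' r(1) by (auto simp: q_def strict_mono_o)
    have Gq: "(\<lambda>j. G (q j)) \<longlonglongrightarrow> liminf G"
      using LIMSEQ_subseq_LIMSEQ[OF r(2) r'(1)] by (simp add: o_def q_def)
    have vm: "v j \<in> borel_measurable lebesgue" "\<bar>v j x\<bar> \<le> 1" for j x
      using v by (auto simp: Xg_iff)
    have um: "u \<in> borel_measurable lebesgue" "\<bar>u x\<bar> \<le> 1" for x
      using u by (auto simp: Xg_iff)
    have "?L u \<le> liminf G"
    proof (cases "well_energy \<Omega> W u = 0")
      case True
      have "Q_energy \<Omega> s u \<le> liminf (\<lambda>j. Q_energy \<Omega> s (v (q j)))"
        by (intro Q_energy_lower_semicontinuous \<Omega> um vm q)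
      also have "\<dots> \<le> liminf (\<lambda>j. e2ennreal (G (q j)))"
        by (intro Liminf_mono always_eventually) (simp add: G)
      also have "\<dots> = e2ennreal (liminf G)"
        using Gq by (intro lim_imp_Liminf tendsto_e2ennrealI) auto
      finally have "enn2ereal (Q_energy \<Omega> s u) \<le> enn2ereal (e2ennreal (liminf G))"
        by (simp add: less_eq_ennreal.rep_eq)
      also have "\<dots> = liminf G"
        by (intro enn2ereal_e2ennreal Liminf_bounded always_eventually) (simp add: G)
      finally show ?thesis using True by simp
    next
      case False
      have "well_energy \<Omega> W u \<le> liminf (\<lambda>j. well_energy \<Omega> W (v (q j)))"
        unfolding well_energy_def using \<Omega>(1)
        by (intro well_energy_lower_semicontinuous W um vm q) auto
      then have "0 < liminf (\<lambda>j. well_energy \<Omega> W (v (q j)))"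
        using False by (metis less_le_trans zero_less_iff_neq_zero)
      then obtain c where "0 < c" "c < liminf (\<lambda>j. well_energy \<Omega> W (v (q j)))"
        using dense by blast
      then have "c \<noteq> top" by auto
      then obtain c' where c: "c = ennreal c'" "0 < c'"
        using \<open>0 < c\<close> by (metis ennreal_cases ennreal_less_zero_iff)
      have ev: "\<forall>\<^sub>F j in sequentially. ennreal c' < well_energy \<Omega> W (v (q j))"
        using less_LiminfD[of c] c \<open>c < _\<close> by blast
      \<comment> \<open>Since \<open>0 < s\<close>, the weight of the well energy blows up while the
        well energy itself eventually stays above \<open>c'\<close>.\<close>
      have "(\<lambda>j. e (q j) powr (2 * s)) \<longlonglongrightarrow> 0"
      proof (rule tendsto_zero_powrI[OF _ tendsto_const])
        show "(\<lambda>j. e (q j)) \<longlonglongrightarrow> 0"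
          using LIMSEQ_subseq_LIMSEQ[OF elim q(1)] by (simp add: o_def)
      qed (use s e0 in \<open>simp_all add: less_imp_le\<close>)
      then have "filterlim (\<lambda>j. inverse (e (q j) powr (2 * s))) at_top sequentially"
        using e0 by (intro filterlim_inverse_at_top) (auto simp: less_imp_neq[symmetric])
      then have top: "filterlim (\<lambda>j. e (q j) powr (- (2 * s)) * c') at_top sequentially"
        unfolding powr_minus
        using filterlim_tendsto_pos_mult_at_top[OF tendsto_const c(2)] by (simp add: mult.commute)
      have "\<forall>\<^sub>F j in sequentially. ereal B < G (q j)" for B
      proof -
        have "\<forall>\<^sub>F j in sequentially. B < e (q j) powr (- (2 * s)) * c'"
          using top by (simp add: filterlim_at_top_dense)
        with ev show ?thesis
        proof eventually_elim
          case (elim j)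
          have "ennreal (e (q j) powr (- (2 * s)) * c') = ennreal (e (q j) powr (- (2 * s))) * ennreal c'"
            using c(2) by (simp add: ennreal_mult)
          also have "\<dots> \<le> ennreal (e (q j) powr (- (2 * s))) * well_energy \<Omega> W (v (q j))"
            using elim(1) by (intro mult_left_mono) auto
          also have "\<dots> \<le> Q_energy \<Omega> s (v (q j)) + ennreal (e (q j) powr (- (2 * s))) * well_energy \<Omega> W (v (q j))"
            by simp
          finally have "enn2ereal (ennreal (e (q j) powr (- (2 * s)) * c')) \<le> G (q j)"
            unfolding G by (simp only: less_eq_ennreal.rep_eq)
          moreover have "ereal B < enn2ereal (ennreal (e (q j) powr (- (2 * s)) * c'))"
            using elim(2) c(2) by (subst enn2ereal_ennreal) auto
          ultimately show ?case by (rule less_le_trans[rotated])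
        qed
      qed
      then have "(\<lambda>j. G (q j)) \<longlonglongrightarrow> \<infinity>"
        unfolding tendsto_PInfty by blast
      with Gq have "liminf G = \<infinity>"
        using LIMSEQ_unique by blast
      then show ?thesis by simp
    qed
    then show "?L u \<le> liminf (\<lambda>j. F_eps \<Omega> s W (e j) (v j) / ereal (e j))"
      unfolding G_def .
  qed
  then show ?thesis
    unfolding vanishing_limit_def by (auto simp: F_eps_rescaled zero_ennreal.rep_eq split: if_splits)
qed

section \<open>Pure phases and their interaction\<close>

definition const_inside :: "(real ^ 'n) set \<Rightarrow> (real ^ 'n \<Rightarrow> real) \<Rightarrow> real \<Rightarrow> real ^ 'n \<Rightarrow> real"
  where "const_inside \<Omega> g c x = (if x \<in> \<Omega> then c else g x)"

lemma const_inside_in_Xg: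
  assumes "open \<Omega>" "continuous_on UNIV g" "\<forall>x. g x \<in> {-1..1}" "\<bar>c\<bar> \<le> 1"
  shows "const_inside \<Omega> g c \<in> Xg \<Omega> g"
proof -
  have "g \<in> borel_measurable borel"
    using assms(2) by (rule borel_measurable_continuous_onI)
  then have g: "g \<in> borel_measurable lebesgue"
    by (intro measurable_completion) simp
  have "\<Omega> \<in> sets lebesgue" using assms(1) by simp
  then have "const_inside \<Omega> g c \<in> borel_measurable lebesgue"
    unfolding const_inside_def[abs_def] by (intro measurable_If_set[OF _ g]) simp_all
  then show ?thesis
    using assms(3,4) unfolding Xg_def const_inside_def by (simp add: abs_le_iff minus_le_iff)
qed

text \<open>The kernel is bounded below on all of \<open>\<Omega> \<times> \<Omega>\<close>, so
  phases \<open>A\<close> and \<open>B\<close> cost at least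
  \<open>\<kappa> * \<bar>A\<bar> * \<bar>B\<bar>\<close>, even across distant pieces of
  \<open>\<Omega>\<close>. Their measures add up to that of \<open>\<Omega>\<close>, so the smaller
  one is controlled by the product; twice that measure is the distance to the nearer pure
  phase.\<close>

lemma L1_dist_const_inside_le_Q_energy:
  fixes \<Omega> :: "(real ^ 'n) set"
  assumes \<Omega>: "open \<Omega>" "bounded \<Omega>" and W: "double_well W" and s: "0 < s"
  obtains C where "0 < C"
    "\<And>v. v \<in> Xg \<Omega> g \<Longrightarrow> well_energy \<Omega> W v = 0 \<Longrightarrow>
      min (L1_dist \<Omega> v (const_inside \<Omega> g 1)) (L1_dist \<Omega> v (const_inside \<Omega> g (-1)))
        \<le> ennreal C * Q_energy \<Omega> s v"
proof -
  have \<Omega>m: "\<Omega> \<in> lmeasurable"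
    using lmeasurable_open[OF \<Omega>(2,1)] .
  then have [measurable]: "\<Omega> \<in> sets lebesgue" by auto
  define m where "m = measure lebesgue \<Omega>"
  define a where "a = real CARD('n) + 2 * s"
  obtain R where R: "0 < R" "\<And>x. x \<in> \<Omega> \<Longrightarrow> norm x \<le> R"
    using \<Omega>(2) bounded_pos by blast
  \<comment> \<open>The numerator is the squared jump between the values 1 and -1, and
    \<open>2 * R\<close> bounds the distance of two points of \<open>\<Omega>\<close>.\<close>
  define \<kappa> where "\<kappa> = 4 / (2 * R) powr a"
  have \<kappa>: "0 < \<kappa>" using R(1) by (simp add: \<kappa>_def)
  \<comment> \<open>One factor 2 is the jump in the distance, the other comes from
    \<open>min a b \<le> 2 * a * b / m\<close>. If \<open>m = 0\<close> both phases are null and any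
    positive constant works.\<close>
  define C where "C = (if m = 0 then 1 else 4 / (\<kappa> * m))"
  have "0 \<le> m" by (simp add: m_def)
  then have C: "0 < C" using \<kappa> by (auto simp: C_def)
  show thesis
  proof (rule that[OF C])
    fix v assume v: "v \<in> Xg \<Omega> g" and v0: "well_energy \<Omega> W v = 0"
    have vm [measurable]: "v \<in> borel_measurable lebesgue" using v by (simp add: Xg_iff)
    have vb: "\<And>x. \<bar>v x\<bar> \<le> 1" using v by (simp add: Xg_iff)
    define A where "A = {x \<in> \<Omega>. v x = 1}"
    define B where "B = {x \<in> \<Omega>. v x = -1}"
    have "{x \<in> \<Omega>. v x = c} \<in> lmeasurable" for c
    proof (rule fmeasurableI2[OF \<Omega>m])
      have "\<Omega> \<inter> (v -` {c} \<inter> space lebesgue) \<in> sets lebesgue"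
        by (intro sets.Int measurable_sets[OF vm] fmeasurableD[OF \<Omega>m]) simp
      also have "\<Omega> \<inter> (v -` {c} \<inter> space lebesgue) = {x \<in> \<Omega>. v x = c}" by auto
      finally show "{x \<in> \<Omega>. v x = c} \<in> sets lebesgue" .
    qed auto
    then have AB: "A \<in> lmeasurable" "B \<in> lmeasurable"
      unfolding A_def B_def by blast+
    have Wm: "(\<lambda>x. W (v x)) \<in> borel_measurable lebesgue"
      by (rule well_measurable[OF W vm vb])
    \<comment> \<open>Vanishing of the integral puts almost every point of \<open>\<Omega>\<close>
      at a zero of \<open>W\<close>, hence in \<open>A\<close> or \<open>B\<close>.\<close>
    have "AE x in lebesgue. ennreal (W (v x)) * indicator \<Omega> x = 0"
      using v0 Wm unfolding well_energy_def by (subst (asm) nn_integral_0_iff_AE) auto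
    then have ae: "AE x in lebesgue. x \<in> \<Omega> \<longrightarrow> x \<in> A \<or> x \<in> B"
    proof eventually_elim
      case (elim x)
      then show ?case
        using double_well_nonneg[OF W vb[of x]] by (auto simp: A_def B_def)
    qed
    have dist: "L1_dist \<Omega> v (const_inside \<Omega> g 1) = ennreal (2 * measure lebesgue B)"
      "L1_dist \<Omega> v (const_inside \<Omega> g (-1)) = ennreal (2 * measure lebesgue A)"
    proof -
      have "L1_dist \<Omega> v (const_inside \<Omega> g 1) = (\<integral>\<^sup>+x. 2 * indicator B x \<partial>lebesgue)"
        unfolding L1_dist_def
      proof (rule nn_integral_cong_AE, use ae in eventually_elim)
        case (elim x)
        then show ?case
          by (cases "x \<in> \<Omega>") (auto simp: const_inside_def A_def B_def)
      qed
      also have "\<dots> = ennreal (2 * measure lebesgue B)"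
        using AB by (simp add: nn_integral_cmult_indicator emeasure_eq_measure2 ennreal_mult)
      finally show "L1_dist \<Omega> v (const_inside \<Omega> g 1) = ennreal (2 * measure lebesgue B)" .
      have "L1_dist \<Omega> v (const_inside \<Omega> g (-1)) = (\<integral>\<^sup>+x. 2 * indicator A x \<partial>lebesgue)"
        unfolding L1_dist_def
      proof (rule nn_integral_cong_AE, use ae in eventually_elim)
        case (elim x)
        then show ?case
          by (cases "x \<in> \<Omega>") (auto simp: const_inside_def A_def B_def)
      qed
      also have "\<dots> = ennreal (2 * measure lebesgue A)"
        using AB by (simp add: nn_integral_cmult_indicator emeasure_eq_measure2 ennreal_mult)
      finally show "L1_dist \<Omega> v (const_inside \<Omega> g (-1)) = ennreal (2 * measure lebesgue A)" .
    qed
    have m: "m = measure lebesgue A + measure lebesgue B"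
    proof -
      have "m = measure lebesgue (A \<union> B)"
        unfolding m_def using ae by (intro measure_eq_AE) (auto simp: A_def B_def)
      also have "\<dots> = measure lebesgue A + measure lebesgue B"
      proof -
        have "A \<inter> B = {}" by (auto simp: A_def B_def)
        then show ?thesis using AB by (simp add: measure_Un3)
      qed
      finally show ?thesis .
    qed
    have "ennreal (\<kappa> * (measure lebesgue A * measure lebesgue B))
        = ennreal \<kappa> * (emeasure lebesgue A * emeasure lebesgue B)"
      using AB \<kappa> by (simp add: emeasure_eq_measure2 ennreal_mult)
    also have "\<dots> \<le> ennreal \<kappa> * emeasure lebesgue (A \<times> B)"
      using AB by (intro mult_left_mono emeasure_lebesgue_Times_ge fmeasurableD) simp_all
    also have "\<dots> = (\<integral>\<^sup>+p. ennreal \<kappa> * indicator (A \<times> B) p \<partial>lebesgue)"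
      using AB by (intro nn_integral_cmult_indicator[symmetric] sets_lebesgue_Times fmeasurableD)
    also have "\<dots> \<le> Q_energy \<Omega> s v"
      unfolding Q_energy_def a_def[symmetric]
    proof (rule nn_integral_mono)
      fix p :: "(real ^ 'n) \<times> (real ^ 'n)"
      show "ennreal \<kappa> * indicator (A \<times> B) p \<le> ennreal (\<bar>v (fst p) - v (snd p)\<bar>\<^sup>2
          / norm (fst p - snd p) powr a) * indicator (Q_set \<Omega>) p"
      proof (cases "p \<in> A \<times> B")
        case True
        then have p: "fst p \<in> \<Omega>" "snd p \<in> \<Omega>" "v (fst p) = 1" "v (snd p) = -1"
          by (simp_all add: A_def B_def mem_Times_iff)
        then have "fst p \<noteq> snd p" by (metis one_neq_neg_one)
        then have "0 < norm (fst p - snd p)" by simp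
        moreover have "norm (fst p - snd p) \<le> 2 * R"
          using norm_triangle_ineq4[of "fst p" "snd p"] R(2)[OF p(1)] R(2)[OF p(2)] by linarith
        moreover have "0 \<le> a" using s by (simp add: a_def)
        ultimately have "\<kappa> \<le> 4 / norm (fst p - snd p) powr a"
          using R(1) unfolding \<kappa>_def by (intro divide_left_mono powr_mono2) auto
        moreover have "p \<in> Q_set \<Omega>" using p by (cases p) (auto simp: Q_set_def)
        ultimately show ?thesis
          using p True by (auto intro!: ennreal_leI)
      qed simp
    qed
    finally have Q: "ennreal (\<kappa> * (measure lebesgue A * measure lebesgue B)) \<le> Q_energy \<Omega> s v" .
    have "2 * min (measure lebesgue A) (measure lebesgue B)
        \<le> C * (\<kappa> * (measure lebesgue A * measure lebesgue B))"
      (is "2 * min ?a ?b \<le> _")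
    proof (cases "m = 0")
      case True
      then have "?a = 0" "?b = 0" using m by (auto simp: add_nonneg_eq_0_iff)
      then show ?thesis by simp
    next
      case False
      then have "0 < m" using \<open>0 \<le> m\<close> by simp
      have "min ?a ?b * m \<le> 2 * (?a * ?b)"
      proof -
        have "min ?a ?b * m = min ?a ?b * ?a + min ?a ?b * ?b" by (simp add: m distrib_left)
        also have "\<dots> \<le> ?b * ?a + ?a * ?b" by (intro add_mono mult_right_mono) auto
        finally show ?thesis by simp
      qed
      then have "2 * min ?a ?b \<le> 4 * (?a * ?b) / m"
        using \<open>0 < m\<close> by (simp add: pos_le_divide_eq mult.commute)
      also have "\<dots> = C * (\<kappa> * (?a * ?b))"
        using False \<kappa> by (simp add: C_def)
      finally show ?thesis .
    qed
    then have "2 * ?b \<le> C * (\<kappa> * (?a * ?b)) \<or> 2 * ?a \<le> C * (\<kappa> * (?a * ?b))"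
      by linarith
    then have "min (ennreal (2 * ?b)) (ennreal (2 * ?a)) \<le> ennreal (C * (\<kappa> * (?a * ?b)))"
      unfolding min_le_iff_disj by (blast intro: ennreal_leI)
    also have "\<dots> \<le> ennreal C * Q_energy \<Omega> s v"
      using Q C by (simp add: ennreal_mult' mult_left_mono)
    finally show "min (L1_dist \<Omega> v (const_inside \<Omega> g 1)) (L1_dist \<Omega> v (const_inside \<Omega> g (-1)))
        \<le> ennreal C * Q_energy \<Omega> s v"
      by (simp only: dist)
  qed
qed

section \<open>Zeroth-order decay and attainment of the first minimum\<close>

lemma well_energy_finite:
  assumes "open \<Omega>" "bounded \<Omega>" "double_well W" "v \<in> Xg \<Omega> g"
  shows "well_energy \<Omega> W v < \<infinity>"
proof -
  have \<Omega>m: "\<Omega> \<in> lmeasurable"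
    using lmeasurable_open[OF assms(2,1)] .
  have "compact (W ` {-1..1})"
    using assms(3) unfolding double_well_def by (intro compact_continuous_image) auto
  then obtain C where C: "\<And>t. t \<in> {-1..1} \<Longrightarrow> \<bar>W t\<bar> \<le> C"
    using compact_imp_bounded bounded_real by (metis imageI)
  have "well_energy \<Omega> W v \<le> (\<integral>\<^sup>+x. ennreal C * indicator \<Omega> x \<partial>lebesgue)"
    unfolding well_energy_def
  proof (intro nn_integral_mono mult_right_mono ennreal_leI)
    fix x
    have "v x \<in> {-1..1}" using assms(4) by (simp add: Xg_def)
    then show "W (v x) \<le> C" using C[of "v x"] by linarith
  qed simp
  also have "\<dots> = ennreal C * emeasure lebesgue \<Omega>"
    using \<Omega>m by (intro nn_integral_cmult_indicator fmeasurableD)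
  also have "\<dots> < \<infinity>"
    using \<Omega>m by (auto simp: fmeasurable_def ennreal_mult_less_top)
  finally show ?thesis .
qed

text \<open>\<open>s < 1 / 2\<close> makes the exponent \<open>1 - 2 * s\<close> positive, so both
  prefactors tend to zero; finiteness of the two energies rules out a limit of the form
  \<open>0 * \<infinity>\<close>.\<close>

lemma F_eps_vanishes:
  assumes "s < 1 / 2" "Q_energy \<Omega> s v < \<infinity>" "well_energy \<Omega> W v < \<infinity>"
  shows "((\<lambda>e. F_eps \<Omega> s W e v) \<longlongrightarrow> 0) (at_right 0)"
proof -
  have "((\<lambda>e::real. ennreal e) \<longlongrightarrow> ennreal 0) (at_right 0)"
    by (intro tendsto_ennrealI tendsto_ident_at)
  then have 1: "((\<lambda>e. ennreal e * Q_energy \<Omega> s v) \<longlongrightarrow> 0 * Q_energy \<Omega> s v) (at_right 0)"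
    using assms(2) by (intro tendsto_mult_ennreal tendsto_const) auto
  have "((\<lambda>e. e powr (1 - 2 * s)) \<longlongrightarrow> 0) (at_right 0)"
    using assms(1) by (intro tendsto_zero_powrI[OF tendsto_ident_at tendsto_const])
      (auto simp: eventually_at_right_less eventually_at_filter)
  then have "((\<lambda>e. ennreal (e powr (1 - 2 * s))) \<longlongrightarrow> ennreal 0) (at_right 0)"
    by (rule tendsto_ennrealI)
  then have 2: "((\<lambda>e. ennreal (e powr (1 - 2 * s)) * well_energy \<Omega> W v) \<longlongrightarrow> 0 * well_energy \<Omega> W v) (at_right 0)"
    using assms(3) by (intro tendsto_mult_ennreal tendsto_const) auto
  have "((\<lambda>e. F_eps \<Omega> s W e v) \<longlongrightarrow> enn2ereal (0 * Q_energy \<Omega> s v + 0 * well_energy \<Omega> W v)) (at_right 0)"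
    unfolding F_eps_def well_energy_def[symmetric]
    by (intro tendsto_enn2erealI tendsto_add 1 2)
  then show ?thesis by (simp add: zero_ennreal.rep_eq)
qed

lemma F_eps_infinite:
  assumes "0 < e" "Q_energy \<Omega> s v = \<infinity>"
  shows "F_eps \<Omega> s W e v = \<infinity>"
  using assms by (simp add: F_eps_def ennreal_mult_top)

text \<open>It suffices to test the two pure phases. If neither were a zero, lower semicontinuity
  would keep the nonlocal energy of two-phase functions above a positive bound near each of them.
  Yet a two-phase function of small energy is close to one of them by the interaction
  estimate.\<close>

lemma first_limit_attains_zero:
  fixes \<Omega> :: "(real ^ 'n) set"
  assumes \<Omega>: "open \<Omega>" "bounded \<Omega>" and W: "double_well W" and s: "0 < s"
    and g: "continuous_on UNIV g" "\<forall>x. g x \<in> {-1..1}"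
    and small: "\<And>\<delta>. 0 < \<delta> \<Longrightarrow> \<exists>v\<in>Xg \<Omega> g. well_energy \<Omega> W v = 0 \<and> Q_energy \<Omega> s v < ennreal \<delta>"
  shows "\<exists>u\<in>Xg \<Omega> g. well_energy \<Omega> W u = 0 \<and> Q_energy \<Omega> s u = 0"
proof (rule ccontr)
  assume none: "\<not> (\<exists>u\<in>Xg \<Omega> g. well_energy \<Omega> W u = 0 \<and> Q_energy \<Omega> s u = 0)"
  have separated: "\<exists>\<delta>>0. \<forall>v\<in>Xg \<Omega> g. well_energy \<Omega> W v = 0 \<longrightarrow>
      L1_dist \<Omega> v (const_inside \<Omega> g c) < ennreal \<delta> \<longrightarrow> ennreal \<delta> < Q_energy \<Omega> s v"
    if c: "\<bar>c\<bar> \<le> 1" for c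
  proof -
    let ?u = "const_inside \<Omega> g c"
    let ?l = "if well_energy \<Omega> W ?u = 0 then enn2ereal (Q_energy \<Omega> s ?u) else \<infinity>"
    have u: "?u \<in> Xg \<Omega> g"
      by (intro const_inside_in_Xg \<Omega> g c)
    then have "gamma_limit_at (Xg \<Omega> g) (L1_dist \<Omega>) (\<lambda>e u. F_eps \<Omega> s W e u / ereal e) ?u ?l"
      using first_gamma_limit[OF \<Omega> W s, of g]
      unfolding vanishing_limit_def is_gamma_limit_def by blast
    moreover have "0 < ?l"
      using none u
      by (auto simp: less_ennreal.rep_eq[symmetric] zero_less_iff_neq_zero
          simp flip: zero_ennreal.rep_eq)
    ultimately obtain \<delta> e where de: "0 < \<delta>" "0 < e"
      "\<And>v. v \<in> Xg \<Omega> g \<Longrightarrow> L1_dist \<Omega> v ?u < ennreal \<delta> \<Longrightarrow> ereal \<delta> < F_eps \<Omega> s W e v / ereal e"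
      by (rule gamma_limit_at_pos_bound) blast
    have "ennreal \<delta> < Q_energy \<Omega> s v"
      if "v \<in> Xg \<Omega> g" "well_energy \<Omega> W v = 0" "L1_dist \<Omega> v ?u < ennreal \<delta>" for v
    proof -
      \<comment> \<open>With zero well energy the quotient is the nonlocal energy whatever
        \<open>e\<close> is, so the bound at a single \<open>e\<close> suffices.\<close>
      have "ereal \<delta> < enn2ereal (Q_energy \<Omega> s v)"
        using de(3)[OF that(1,3)] that(2) de(2) by (simp add: F_eps_rescaled)
      then show ?thesis
        using de(1) by (simp add: less_ennreal.rep_eq enn2ereal_ennreal)
    qed
    with de(1) show ?thesis by blast
  qed
  obtain \<delta>1 where \<delta>1: "0 < \<delta>1" "\<And>v. v \<in> Xg \<Omega> g \<Longrightarrow> well_energy \<Omega> W v = 0 \<Longrightarrow>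
      L1_dist \<Omega> v (const_inside \<Omega> g 1) < ennreal \<delta>1 \<Longrightarrow> ennreal \<delta>1 < Q_energy \<Omega> s v"
    using separated[of 1] by auto
  obtain \<delta>2 where \<delta>2: "0 < \<delta>2" "\<And>v. v \<in> Xg \<Omega> g \<Longrightarrow> well_energy \<Omega> W v = 0 \<Longrightarrow>
      L1_dist \<Omega> v (const_inside \<Omega> g (-1)) < ennreal \<delta>2 \<Longrightarrow> ennreal \<delta>2 < Q_energy \<Omega> s v"
    using separated[of "-1"] by auto
  obtain C where C: "0 < C" "\<And>v. v \<in> Xg \<Omega> g \<Longrightarrow> well_energy \<Omega> W v = 0 \<Longrightarrow>
      min (L1_dist \<Omega> v (const_inside \<Omega> g 1)) (L1_dist \<Omega> v (const_inside \<Omega> g (-1)))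
        \<le> ennreal C * Q_energy \<Omega> s v"
    using L1_dist_const_inside_le_Q_energy[OF \<Omega> W s, of g] by metis
  define \<delta> where "\<delta> = min \<delta>1 \<delta>2"
  have \<delta>: "0 < \<delta>" "\<delta> \<le> \<delta>1" "\<delta> \<le> \<delta>2" using \<delta>1(1) \<delta>2(1) by (auto simp: \<delta>_def)
  \<comment> \<open>The bound \<open>\<delta> / C\<close> forces \<open>v\<close> within
    \<open>\<delta>\<close> of a pure phase, and the bound \<open>\<delta>\<close> contradicts the
    separation there.\<close>
  obtain v where v: "v \<in> Xg \<Omega> g" "well_energy \<Omega> W v = 0" "Q_energy \<Omega> s v < ennreal (min \<delta> (\<delta> / C))"
    using small[of "min \<delta> (\<delta> / C)"] \<delta>(1) C(1) by auto
  have Q: "Q_energy \<Omega> s v < ennreal \<delta>"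
    using v(3) by (rule less_le_trans) (simp add: ennreal_leI)
  have "ennreal C * Q_energy \<Omega> s v < ennreal C * ennreal (\<delta> / C)"
  proof (rule ennreal_mult_strict_left_mono)
    show "Q_energy \<Omega> s v < ennreal (\<delta> / C)"
      using v(3) by (rule less_le_trans) (simp add: ennreal_leI)
  qed (use C(1) in auto)
  also have "\<dots> = ennreal \<delta>"
    using C(1) \<delta>(1) by (simp flip: ennreal_mult)
  finally have "L1_dist \<Omega> v (const_inside \<Omega> g 1) < ennreal \<delta>
      \<or> L1_dist \<Omega> v (const_inside \<Omega> g (-1)) < ennreal \<delta>"
    using C(2)[OF v(1,2)] by (auto simp: min_le_iff_disj)
  then show False
  proof
    assume "L1_dist \<Omega> v (const_inside \<Omega> g 1) < ennreal \<delta>"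
    then have "ennreal \<delta>1 < Q_energy \<Omega> s v"
      using \<delta>(2) by (intro \<delta>1(2) v) (auto intro: less_le_trans ennreal_leI)
    with Q show False using \<delta>(2) by (meson ennreal_leI less_le_trans not_less_iff_gr_or_eq)
  next
    assume "L1_dist \<Omega> v (const_inside \<Omega> g (-1)) < ennreal \<delta>"
    then have "ennreal \<delta>2 < Q_energy \<Omega> s v"
      using \<delta>(3) by (intro \<delta>2(2) v) (auto intro: less_le_trans ennreal_leI)
    with Q show False using \<delta>(3) by (meson ennreal_leI less_le_trans not_less_iff_gr_or_eq)
  qed
qed

lemma L1_dist_refl [simp]: "L1_dist \<Omega> u u = 0"
  by (simp add: L1_dist_def)

section \<open>Stationarity of the development\<close>

theorem theorem1p3:
  fixes \<Omega> :: "(real ^ 'n) set" and s :: real and W :: "real \<Rightarrow> real"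
    and g :: "real ^ 'n \<Rightarrow> real" and k :: nat
  assumes "0 < s" and "s < 1 / 2"
    and "bounded_lipschitz_domain \<Omega>"
    and "double_well W"
    and "continuous_on UNIV g" and "\<forall>x. g x \<in> {-1..1}"
    and "dev_min (Xg \<Omega> g) (L1_dist \<Omega>) (F_eps \<Omega> s W) 1 = 0"
    and "2 \<le> k"
  shows "is_gamma_limit (Xg \<Omega> g) (L1_dist \<Omega>) (dev_eps (Xg \<Omega> g) (L1_dist \<Omega>) (F_eps \<Omega> s W) k)
           (dev_lim (Xg \<Omega> g) (L1_dist \<Omega>) (F_eps \<Omega> s W) k)
    \<and> (\<forall>u\<in>Xg \<Omega> g. dev_lim (Xg \<Omega> g) (L1_dist \<Omega>) (F_eps \<Omega> s W) k u =
         (if u \<in> dev_set (Xg \<Omega> g) (L1_dist \<Omega>) (F_eps \<Omega> s W) 1 then 0 else \<infinity>))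
    \<and> dev_min (Xg \<Omega> g) (L1_dist \<Omega>) (F_eps \<Omega> s W) k = 0
    \<and> dev_set (Xg \<Omega> g) (L1_dist \<Omega>) (F_eps \<Omega> s W) k
        = dev_set (Xg \<Omega> g) (L1_dist \<Omega>) (F_eps \<Omega> s W) 1"
proof -
  let ?X = "Xg \<Omega> g" and ?d = "L1_dist \<Omega>" and ?F = "F_eps \<Omega> s W"
  \<comment> \<open>The well energy is finite on all of \<open>?X\<close>, so \<open>D\<close> is
    exactly where the functionals are finite.\<close>
  define D where "D = {u \<in> ?X. Q_energy \<Omega> s u < \<infinity>}"
  define L where "L = (\<lambda>u. if well_energy \<Omega> W u = 0 then enn2ereal (Q_energy \<Omega> s u) else \<infinity>)"
  have \<Omega>: "open \<Omega>" "bounded \<Omega>"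
    using assms(3) by (auto simp: bounded_lipschitz_domain_def)
  have first: "dev_eps ?X ?d ?F 1 = (\<lambda>e u. ?F e u / ereal e) \<and> D \<subseteq> dev_dom ?X ?d ?F 1"
  proof (rule dev_level_one_of_finiteness_domain)
    show "D \<subseteq> ?X" by (auto simp: D_def)
    show "((\<lambda>e. ?F e v) \<longlongrightarrow> 0) (at_right 0)" if "v \<in> D" for v
      using that unfolding D_def
      by (intro F_eps_vanishes assms(2) well_energy_finite[OF \<Omega> assms(4), of v g]) auto
    show "?F e v = \<infinity>" if "0 < e" "v \<in> ?X - D" for e v
      using that unfolding D_def by (intro F_eps_infinite) (auto simp: not_less top_unique)
  qed (use assms(7) in \<open>auto simp: F_eps_def\<close>)
  then have van: "vanishing_limit ?X ?d (dev_eps ?X ?d ?F 1) L"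
    using first_gamma_limit[OF \<Omega> assms(4,1), of g] unfolding L_def by simp
  have L0: "L u = 0 \<longleftrightarrow> well_energy \<Omega> W u = 0 \<and> Q_energy \<Omega> s u = 0" for u
    unfolding L_def by (metis PInfty_neq_ereal(1) enn2ereal_inject zero_ennreal.rep_eq zero_ereal_def)
  have sub: "dev_dom ?X ?d ?F 1 \<subseteq> ?X" by auto
  \<comment> \<open>A zero of \<open>L\<close> has zero nonlocal energy, hence lies in
    \<open>D\<close>; this is the lower inclusion that \<open>dev_stationary\<close> asks for at
    level 1.\<close>
  have dom: "{u \<in> ?X. L u = 0} \<subseteq> dev_dom ?X ?d ?F 1"
    using first by (auto simp: L0 D_def)
  have "\<exists>u\<in>?X. L u = 0"
    unfolding L0
  proof (rule first_limit_attains_zero[OF \<Omega> assms(4,1,5,6)])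
    fix \<delta> :: real assume "0 < \<delta>"
    then have "dev_min ?X ?d ?F 1 < ereal \<delta>"
      using assms(7) by simp
    then obtain v where v: "v \<in> dev_dom ?X ?d ?F 1" "dev_lim ?X ?d ?F 1 v < ereal \<delta>"
      unfolding dev_min_def INF_less_iff by blast
    then have "v \<in> ?X" using sub by blast
    then have "L v < ereal \<delta>"
      using v(2) van gamma_lim_eq unfolding vanishing_limit_def dev_lim_def by metis
    then have "well_energy \<Omega> W v = 0 \<and> Q_energy \<Omega> s v < ennreal \<delta>"
      using \<open>0 < \<delta>\<close> by (simp add: L_def less_ennreal.rep_eq enn2ereal_ennreal split: if_splits)
    with \<open>v \<in> ?X\<close> show "\<exists>v\<in>?X. well_energy \<Omega> W v = 0 \<and> Q_energy \<Omega> s v < ennreal \<delta>"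
      by blast
  qed
  from dev_stationary[OF van dom sub this _ order.strict_trans2[OF _ assms(8)]]
  have lim: "is_gamma_limit ?X ?d (dev_eps ?X ?d ?F k) (\<lambda>u. if L u = 0 then 0 else \<infinity>)"
    and "dev_min ?X ?d ?F k = 0" "dev_set ?X ?d ?F k = {u \<in> ?X. L u = 0}"
    and one: "dev_set ?X ?d ?F 1 = {u \<in> ?X. L u = 0}"
    by simp_all
  \<comment> \<open>\<open>dev_lim\<close> is a definite description; existence of the limit in
    \<open>lim\<close> and uniqueness identify its value.\<close>
  moreover have val: "dev_lim ?X ?d ?F k u = (if L u = 0 then 0 else \<infinity>)" if "u \<in> ?X" for u
    unfolding dev_lim_def by (rule gamma_lim_eq[OF lim that])
  moreover have "is_gamma_limit ?X ?d (dev_eps ?X ?d ?F k) (dev_lim ?X ?d ?F k)"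
    using lim val by (simp add: is_gamma_limit_def)
  ultimately show ?thesis
    unfolding one by auto
qed

end
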